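(* Let $m\ge3$. Write $\mathbb F_2^{2m}=\mathbb F_2^{2(m-3)}\oplus\mathbb F_2^6$ and let $A\subset\mathbb F_2^{2(m-3)}$ be the totally isotropic subspace defined by $x_2=x_4=\cdots=x_{2m-6}=0$ (so $A=0$ if $m=3$). For $1\le i\le30$ let $X_i$ be the variable corresponding to the maximal totally isotropic subspace $A\oplus Y_i\subset\mathbb F_2^{2m}$, where $Y_1,\dots,Y_{30}\subset\mathbb F_2^6$ are the thirty maximal totally isotropic subspaces of $\mathbb F_2^6$ in the numbering given in the context. Then the quartic polynomial $$(X_{29}-X_{30})(X_{17}-X_{18})(X_{27}-X_{28})(X_{7}-X_{8})+(X_{11}-X_{12})(X_{13}-X_{14})(X_{15}-X_{16})(X_{21}-X_{22})$$ is contained in the ideal $\mathcal I_m\subset\mathcal R_m$.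
   Context: $\mathbb F_2^{2m}$ carries the quadratic form $q(x)=x_1x_2+\cdots+x_{2m-1}x_{2m}$, with orthogonal group $\mathrm O(\mathbb F_2^{2m})$. A subspace is totally isotropic if $q$ vanishes on it; maximal ones have dimension $m$. **The thirty spaces** (each line lists a basis; $abcdef$ means the vector $(a,b,c,d,e,f)\in\mathbb F_2^6$): $Y_1$: 000001, 000100, 010000; $Y_2$: 000001, 000100, 100000; $Y_3$: 000001, 001000, 010000; $Y_4$: 000001, 001000, 100000; $Y_5$: 000001, 010100, 101000; $Y_6$: 000001, 011000, 100100; $Y_7$: 000010, 000100, 010000; $Y_8$: 000010, 000100, 100000; $Y_9$: 000010, 001000, 010000; $Y_{10}$: 000010, 001000, 100000; $Y_{11}$: 000010, 010100, 101000; $Y_{12}$: 000010, 011000, 100100; $Y_{13}$: 000100, 010001, 100010; $Y_{14}$: 000100, 010010, 100001; $Y_{15}$: 000101, 001010, 010000; $Y_{16}$: 000101, 001010, 100000; $Y_{17}$: 000101, 010001, 101010; $Y_{18}$: 000101, 011010, 100001; $Y_{19}$: 000110, 001001, 010000; $Y_{20}$: 000110, 001001, 100000; $Y_{21}$: 000110, 010010, 101001; $Y_{22}$: 000110, 011001, 100010; $Y_{23}$: 001000, 010001, 100010; $Y_{24}$: 001000, 010010, 100001; $Y_{25}$: 001001, 010001, 100110; $Y_{26}$: 001001, 010110, 100001; $Y_{27}$: 001010, 010010, 100101; $Y_{28}$: 001010, 010101, 100010; $Y_{29}$: 001111, 010101, 100110; $Y_{30}$: 001111, 010110, 100101. **The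 ideal $\mathcal I_m\subset\mathcal R_m$.** Take a variable $X_A$ for each maximal totally isotropic $A\subset\mathbb F_2^{2m}$ and let $\mathcal R_m$ be the subalgebra of $\mathbb C[\dots,X_A,\dots]$ generated by all differences $X_A-X_B$. Write $\mathbb F_2^{2m}=\mathbb F_2^{2m-4}\oplus\mathbb F_2^4$, let $A_0\subset\mathbb F_2^{2m-4}$ be defined by $x_2=x_4=\cdots=x_{2m-4}=0$, and let $I_j=A_0\oplus B_j$ ($1\le j\le 6$) with $B_1=\langle1000,0010\rangle$, $B_2=\langle1000,0001\rangle$, $B_3=\langle0100,0001\rangle$, $B_4=\langle0100,0010\rangle$, $B_5=\langle1001,0110\rangle$, $B_6=\langle1010,0101\rangle$. For $g\in\mathrm O(\mathbb F_2^{2m})$ put $Z_j=X_{g(I_j)}$. The ideal $\mathcal I_m$ is generated, for all $g$, by $Z_1+Z_3+Z_5-Z_2-Z_4-Z_6$ and the differences (left side minus right side) of $(Z_1-Z_2)(Z_1-Z_4)=(Z_3-Z_6)(Z_5-Z_6)$, $(Z_1-Z_2)(Z_3-Z_2)=(Z_5-Z_4)(Z_5-Z_6)$, $(Z_1-Z_2)(Z_1-Z_6)=(Z_3-Z_4)(Z_5-Z_4)$, $(Z_1-Z_2)(Z_5-Z_2)=(Z_3-Z_4)(Z_3-Z_6)$, $(Z_3-Z_4)(Z_1-Z_4)=(Z_5-Z_2)(Z_5-Z_6)$, $(Z_3-Z_4)(Z_3-Z_2)=(Z_1-Z_6)(Z_5-Z_6)$, $(Z_1-Z_4)(Z_1-Z_6)=(Z_3-Z_2)(Z_5-Z_2)$,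 $(Z_1-Z_4)(Z_5-Z_4)=(Z_3-Z_2)(Z_3-Z_6)$, $(Z_1-Z_6)(Z_3-Z_6)=(Z_5-Z_2)(Z_5-Z_4)$. *)

theory Defs
  imports
    Complex_Main
    "HOL-Library.Z2"
    "HOL-Library.Poly_Mapping"
    "HOL-Algebra.Generated_Rings"
    "Jordan_Normal_Form.VS_Connect"
begin

section \<open>The quadratic space\<close>

text \<open>
  Vectors over the two-element field have type \<^typ>\<open>bit vec\<close>, with entries numbered from 0;
  the coordinates $x_{2i+1}, x_{2i+2}$ of the usual numbering are the entries $2i$ and $2i+1$.
\<close>

abbreviation F2_space :: "nat \<Rightarrow> (bit, bit vec) Module.module" where
  "F2_space n \<equiv> module_vec TYPE(bit) n"

definition quad :: "nat \<Rightarrow> bit vec \<Rightarrow> bit" where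
  "quad m v = (\<Sum>i<m. v $ (2 * i) * v $ (2 * i + 1))"

definition orthogonal_group :: "nat \<Rightarrow> bit mat set" where
  "orthogonal_group m =
    {g \<in> carrier_mat (2 * m) (2 * m). invertible_mat g \<and>
       (\<forall>v \<in> carrier_vec (2 * m). quad m (g *\<^sub>v v) = quad m v)}"

definition totally_isotropic :: "nat \<Rightarrow> bit vec set \<Rightarrow> bool" where
  "totally_isotropic m W \<longleftrightarrow>
     VectorSpace.subspace class_ring W (F2_space (2 * m)) \<and> (\<forall>v \<in> W. quad m v = 0)"

definition max_totally_isotropic :: "nat \<Rightarrow> bit vec set \<Rightarrow> bool" where
  "max_totally_isotropic m W \<longleftrightarrow>
     totally_isotropic m W \<and> (\<forall>W'. totally_isotropic m W' \<longrightarrow> W \<subseteq> W' \<longrightarrow> W' = W)"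

text \<open>The subspace of $\mathbb F_2^{2k}$ given by $x_2 = x_4 = \cdots = x_{2k} = 0$.\<close>

definition std_isotropic :: "nat \<Rightarrow> bit vec set" where
  "std_isotropic k = {v \<in> carrier_vec (2 * k). \<forall>i<k. v $ (2 * i + 1) = 0}"

text \<open>$U \oplus W$ inside $\mathbb F_2^{a} \oplus \mathbb F_2^{b} = \mathbb F_2^{a+b}$,
  the first summand taking the first $a$ coordinates.\<close>

definition dsum :: "bit vec set \<Rightarrow> bit vec set \<Rightarrow> bit vec set" where
  "dsum U W = {u @\<^sub>v w | u w. u \<in> U \<and> w \<in> W}"

definition list_span :: "nat \<Rightarrow> bit list list \<Rightarrow> bit vec set" where
  "list_span n bs = LinearCombinations.module.span class_ring (F2_space n) (set (map vec_of_list bs))"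

definition Y_bases :: "bit list list list" where
  "Y_bases = [
    [[0,0,0,0,0,1], [0,0,0,1,0,0], [0,1,0,0,0,0]],
    [[0,0,0,0,0,1], [0,0,0,1,0,0], [1,0,0,0,0,0]],
    [[0,0,0,0,0,1], [0,0,1,0,0,0], [0,1,0,0,0,0]],
    [[0,0,0,0,0,1], [0,0,1,0,0,0], [1,0,0,0,0,0]],
    [[0,0,0,0,0,1], [0,1,0,1,0,0], [1,0,1,0,0,0]],
    [[0,0,0,0,0,1], [0,1,1,0,0,0], [1,0,0,1,0,0]],
    [[0,0,0,0,1,0], [0,0,0,1,0,0], [0,1,0,0,0,0]],
    [[0,0,0,0,1,0], [0,0,0,1,0,0], [1,0,0,0,0,0]],
    [[0,0,0,0,1,0], [0,0,1,0,0,0], [0,1,0,0,0,0]],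
    [[0,0,0,0,1,0], [0,0,1,0,0,0], [1,0,0,0,0,0]],
    [[0,0,0,0,1,0], [0,1,0,1,0,0], [1,0,1,0,0,0]],
    [[0,0,0,0,1,0], [0,1,1,0,0,0], [1,0,0,1,0,0]],
    [[0,0,0,1,0,0], [0,1,0,0,0,1], [1,0,0,0,1,0]],
    [[0,0,0,1,0,0], [0,1,0,0,1,0], [1,0,0,0,0,1]],
    [[0,0,0,1,0,1], [0,0,1,0,1,0], [0,1,0,0,0,0]],
    [[0,0,0,1,0,1], [0,0,1,0,1,0], [1,0,0,0,0,0]],
    [[0,0,0,1,0,1], [0,1,0,0,0,1], [1,0,1,0,1,0]],
    [[0,0,0,1,0,1], [0,1,1,0,1,0], [1,0,0,0,0,1]],
    [[0,0,0,1,1,0], [0,0,1,0,0,1], [0,1,0,0,0,0]],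
    [[0,0,0,1,1,0], [0,0,1,0,0,1], [1,0,0,0,0,0]],
    [[0,0,0,1,1,0], [0,1,0,0,1,0], [1,0,1,0,0,1]],
    [[0,0,0,1,1,0], [0,1,1,0,0,1], [1,0,0,0,1,0]],
    [[0,0,1,0,0,0], [0,1,0,0,0,1], [1,0,0,0,1,0]],
    [[0,0,1,0,0,0], [0,1,0,0,1,0], [1,0,0,0,0,1]],
    [[0,0,1,0,0,1], [0,1,0,0,0,1], [1,0,0,1,1,0]],
    [[0,0,1,0,0,1], [0,1,0,1,1,0], [1,0,0,0,0,1]],
    [[0,0,1,0,1,0], [0,1,0,0,1,0], [1,0,0,1,0,1]],
    [[0,0,1,0,1,0], [0,1,0,1,0,1], [1,0,0,0,1,0]],
    [[0,0,1,1,1,1], [0,1,0,1,0,1], [1,0,0,1,1,0]],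
    [[0,0,1,1,1,1], [0,1,0,1,1,0], [1,0,0,1,0,1]]]"

text \<open>Meaningful for $1 \le i \le 30$.\<close>

definition Y_space :: "nat \<Rightarrow> bit vec set" where
  "Y_space i = list_span 6 (Y_bases ! (i - 1))"

definition B_bases :: "bit list list list" where
  "B_bases = [
    [[1,0,0,0], [0,0,1,0]],
    [[1,0,0,0], [0,0,0,1]],
    [[0,1,0,0], [0,0,0,1]],
    [[0,1,0,0], [0,0,1,0]],
    [[1,0,0,1], [0,1,1,0]],
    [[1,0,1,0], [0,1,0,1]]]"

text \<open>Meaningful for $1 \le j \le 6$.\<close>

definition B_space :: "nat \<Rightarrow> bit vec set" where
  "B_space j = list_span 4 (B_bases ! (j - 1))"

definition I_space :: "nat \<Rightarrow> nat \<Rightarrow> bit vec set" where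
  "I_space m j = dsum (std_isotropic (m - 2)) (B_space j)"


section \<open>The ring and the ideal\<close>

text \<open>
  A polynomial maps monomials (finitely supported exponent functions) to coefficients. Every set
  of vectors is allowed as the index of a variable here; \<open>diff_ring\<close> uses only the variables
  of maximal totally isotropic subspaces.
\<close>

type_synonym cpoly = "(bit vec set \<Rightarrow>\<^sub>0 nat) \<Rightarrow>\<^sub>0 complex"

definition Xvar :: "bit vec set \<Rightarrow> cpoly" where
  "Xvar A = Poly_Mapping.single (Poly_Mapping.single A 1) 1"

definition constants :: "cpoly set" where
  "constants = range (Poly_Mapping.single 0)"

text \<open>
  The subalgebra generated by a set is the subring generated by that set and the constants.
  (The locale \<open>subalgebra\<close> of HOL-Algebra does not require closure under multiplication.)
\<close>

definition diff_ring :: "nat \<Rightarrow> cpoly set" where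
  "diff_ring m = generate_ring class_ring
     (constants \<union> {Xvar A - Xvar A' | A A'. max_totally_isotropic m A \<and> max_totally_isotropic m A'})"

definition relations :: "(nat \<Rightarrow> cpoly) \<Rightarrow> cpoly set" where
  "relations Z = {
     Z 1 + Z 3 + Z 5 - Z 2 - Z 4 - Z 6,
     (Z 1 - Z 2) * (Z 1 - Z 4) - (Z 3 - Z 6) * (Z 5 - Z 6),
     (Z 1 - Z 2) * (Z 3 - Z 2) - (Z 5 - Z 4) * (Z 5 - Z 6),
     (Z 1 - Z 2) * (Z 1 - Z 6) - (Z 3 - Z 4) * (Z 5 - Z 4),
     (Z 1 - Z 2) * (Z 5 - Z 2) - (Z 3 - Z 4) * (Z 3 - Z 6),
     (Z 3 - Z 4) * (Z 1 - Z 4) - (Z 5 - Z 2) * (Z 5 - Z 6),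
     (Z 3 - Z 4) * (Z 3 - Z 2) - (Z 1 - Z 6) * (Z 5 - Z 6),
     (Z 1 - Z 4) * (Z 1 - Z 6) - (Z 3 - Z 2) * (Z 5 - Z 2),
     (Z 1 - Z 4) * (Z 5 - Z 4) - (Z 3 - Z 2) * (Z 3 - Z 6),
     (Z 1 - Z 6) * (Z 3 - Z 6) - (Z 5 - Z 2) * (Z 5 - Z 4)}"

definition rel_ideal :: "nat \<Rightarrow> cpoly set" where
  "rel_ideal m = genideal (class_ring\<lparr>carrier := diff_ring m\<rparr>)
     (\<Union>g \<in> orthogonal_group m. relations (\<lambda>j. Xvar ((*\<^sub>v) g ` I_space m j)))"

end

theory Submission
  imports Defs
begin

text \<open>
  The thirty spaces form two families of fifteen, the points and the planes of a projective 3-space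
  over the two-element field; the six of them that contain a given singular vector are the three
  points on a line and the three planes through it. Modulo the linear relation of a line, its nine
  quadratic relations coincide: together they say that the three points and the three planes have
  the same sum and the same sum of squares.

  A null polarity pairs every point $p_{ij}$ with a plane $q_{ij}$ through it, where $ij$ runs over
  the duads of a six-element set. A line then carries either $p_{ij}, p_{kl}, p_{mn}$ and
  $q_{ij}, q_{kl}, q_{mn}$, or $p_{ij}, p_{jk}, p_{ik}$ and $q_{lm}, q_{mn}, q_{ln}$. Put
  $l = p - q$, $m = p + q$ and $U_i = \sum_j l_{ij}$. Modulo the ideal, $4 l_{ij} = U_i + U_j$,
  $\sum_i U_i = 0$, the products $l m = p^2 - q^2$ satisfy the same linear relations as $l$, and
  $\sum_j m_{ij}$ and $\sum_j (p_{ij}^2 + q_{ij}^2)$ do not depend on $i$. Multiplying the last sum by $U_i$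
  and adding over $i$ gives $\sum_i U_i^3 = 0$. Up to a constant, the quartic is
  $\prod_{i \le 4} (U_i + U_6) - \prod_{i \le 4} (U_i + U_5)$, which equals $(U_6 - U_5)\, e_3(U)$
  when $\sum_i U_i = 0$, and then $3 e_3(U) = \sum_i U_i^3$.
\<close>

section \<open>Congruences modulo an ideal of a subring\<close>

text \<open>The ring operations are those of the type, so \<open>algebra_simps\<close> stays
  available and only membership has to be tracked. \<open>J\<close> absorbs factors from
  \<open>R\<close> alone: \<open>R\<close> will be the algebra of differences, not the whole
  polynomial ring.\<close>

locale subring_ideal =
  fixes R J :: "'a :: comm_ring_1 set"
  assumes one_closed [simp]: "1 \<in> R"
    and diff_closed [simp]: "a \<in> R \<Longrightarrow> b \<in> R \<Longrightarrow> a - b \<in> R"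
    and mult_closed [simp]: "a \<in> R \<Longrightarrow> b \<in> R \<Longrightarrow> a * b \<in> R"
    and ideal_subset: "a \<in> J \<Longrightarrow> a \<in> R"
    and ideal_zero: "0 \<in> J"
    and ideal_add: "a \<in> J \<Longrightarrow> b \<in> J \<Longrightarrow> a + b \<in> J"
    and ideal_mult: "a \<in> J \<Longrightarrow> r \<in> R \<Longrightarrow> a * r \<in> J"
begin

lemma zero_closed [simp]: "0 \<in> R"
  using ideal_subset ideal_zero by blast

lemma uminus_closed [simp]: "a \<in> R \<Longrightarrow> - a \<in> R"
  using diff_closed[of 0 a] by simp

lemma add_closed [simp]: "a \<in> R \<Longrightarrow> b \<in> R \<Longrightarrow> a + b \<in> R"
  using diff_closed[of a "- b"] by simp

lemma sum_closed [simp]: "(\<And>i. i \<in> I \<Longrightarrow> f i \<in> R) \<Longrightarrow> sum f I \<in> R"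
  by (induction I rule: infinite_finite_induct) auto

lemma of_nat_closed: "of_nat n \<in> R"
  by (induction n) auto

lemma numeral_closed [simp]: "numeral n \<in> R"
  using of_nat_closed[of "numeral n"] by simp

lemma power_closed [simp]: "a \<in> R \<Longrightarrow> a ^ n \<in> R"
  by (induction n) auto

lemma ideal_uminus: "a \<in> J \<Longrightarrow> - a \<in> J"
  using ideal_mult[of a "- 1"] by simp

lemma ideal_diff: "a \<in> J \<Longrightarrow> b \<in> J \<Longrightarrow> a - b \<in> J"
  using ideal_add[of a "- b"] ideal_uminus[of b] by simp

text \<open>The argument below multiplies by integers instead of dividing. This removes the
  accumulated factor at the end, once it is known to have an inverse in \<open>R\<close>.\<close>

lemma ideal_cancel:
  assumes "u * a \<in> J" "v \<in> R" "u * v = 1"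
  shows "a \<in> J"
proof -
  have "u * a * v = a * (u * v)"
    by (simp only: ac_simps)
  with ideal_mult[OF assms(1,2)] assms(3) show ?thesis
    by simp
qed

text \<open>Both sides must lie in \<open>R\<close>, since \<open>cong_mult\<close> multiplies
  elements of \<open>J\<close> by one side of a congruence and \<open>J\<close> absorbs only
  elements of \<open>R\<close>.\<close>

definition cong :: "'a \<Rightarrow> 'a \<Rightarrow> bool" (infix \<open>\<approx>\<close> 50)
  where "a \<approx> b \<longleftrightarrow> a \<in> R \<and> b \<in> R \<and> a - b \<in> J"

lemma cong_refl [simp]: "a \<in> R \<Longrightarrow> a \<approx> a"
  by (simp add: cong_def ideal_zero)

lemma cong_sym: "a \<approx> b \<Longrightarrow> b \<approx> a"
  using ideal_uminus[of "a - b"] by (simp add: cong_def)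

lemma cong_trans [trans]: "a \<approx> b \<Longrightarrow> b \<approx> c \<Longrightarrow> a \<approx> c"
  using ideal_add[of "a - b" "b - c"] by (simp add: cong_def)

lemma cong_add: "a \<approx> b \<Longrightarrow> c \<approx> d \<Longrightarrow> a + c \<approx> b + d"
  using ideal_add[of "a - b" "c - d"] by (simp add: cong_def algebra_simps)

lemma cong_diff: "a \<approx> b \<Longrightarrow> c \<approx> d \<Longrightarrow> a - c \<approx> b - d"
  using ideal_diff[of "a - b" "c - d"] by (simp add: cong_def algebra_simps)

lemma cong_mult:
  assumes "a \<approx> b" "c \<approx> d"
  shows "a * c \<approx> b * d"
proof -
  have "(a - b) * c + (c - d) * b \<in> J"
    using assms by (intro ideal_add ideal_mult) (auto simp: cong_def)
  also have "(a - b) * c + (c - d) * b = a * c - b * d"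
    by (simp add: algebra_simps)
  finally show ?thesis
    using assms by (simp add: cong_def)
qed

lemma cong_power: "a \<approx> b \<Longrightarrow> a ^ n \<approx> b ^ n"
  by (induction n) (auto intro: cong_mult)

lemma cong_sum: "(\<And>i. i \<in> I \<Longrightarrow> f i \<approx> g i) \<Longrightarrow> sum f I \<approx> sum g I"
  by (induction I rule: infinite_finite_induct) (auto intro: cong_add)

lemma cong_mult_0: "a \<approx> 0 \<Longrightarrow> r \<in> R \<Longrightarrow> a * r \<approx> 0"
  using cong_mult[of a 0 r r] by simp

lemma cong_0_iff: "a \<approx> 0 \<longleftrightarrow> a \<in> J"
  using ideal_subset by (auto simp: cong_def)

end

section \<open>Labellings of the duads of a six-element set\<close>

definition duad_labelling :: "(nat \<Rightarrow> nat \<Rightarrow> 'a :: comm_ring_1) \<Rightarrow> bool" where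
  "duad_labelling p \<longleftrightarrow> (\<forall>i j. p i j = p j i) \<and> (\<forall>i. p i i = 0)"

text \<open>The two shapes make up the 35 lines: 15 synthemes ij|kl|mn, and 20 choices of a triangle
  ijk for the points with the opposite triangle lmn for the planes. Leaving \<open>p\<close> and
  \<open>q\<close> arbitrary lets the same predicate be used for their squares.\<close>

definition line_relations :: "'a set \<Rightarrow> (nat \<Rightarrow> nat \<Rightarrow> 'a :: comm_ring_1) \<Rightarrow> (nat \<Rightarrow> nat \<Rightarrow> 'a) \<Rightarrow> bool" where
  "line_relations J p q \<longleftrightarrow>
    (\<forall>i j k l m n. distinct [i, j, k, l, m, n] \<longrightarrow> {i, j, k, l, m, n} = {..<6} \<longrightarrow>
       p i j + p k l + p m n - (q i j + q k l + q m n) \<in> J \<and>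
       p i j + p j k + p i k - (q l m + q m n + q l n) \<in> J)"

lemma lessThan_6: "{0, 1, 2, 3, 4, 5} = {..<6::nat}"
  by (rule Set.set_eqI) (simp, presburger)

lemma sum_lessThan_6: "(\<Sum>i<6::nat. f i) = f 0 + f 1 + f 2 + f 3 + f 4 + (f 5 :: 'a :: comm_monoid_add)"
  by (simp add: lessThan_nat_numeral lessThan_Suc ac_simps)

lemma prod_lessThan_4: "(\<Prod>i<4::nat. f i) = f 0 * f 1 * f 2 * (f 3 :: 'a :: comm_monoid_mult)"
  by (simp add: lessThan_nat_numeral lessThan_Suc ac_simps)

text \<open>Write E_k and P_k for the elementary symmetric polynomials and power sums of the six
  variables. The difference of products is (f - e) (E_3 + E_1 (e^2 + f^2)), and Newton's identity 6
  E_3 = E_1^3 - 3 E_1 P_2 + 2 P_3 eliminates E_3. The cofactor of E_1 is explicit because E_1 will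
  vanish only modulo the ideal.\<close>

lemma star_product_difference:
  fixes a b c d e f :: "'a :: comm_ring_1"
  shows "12 * ((a + f) * (b + f) * (c + f) * (d + f) - (a + e) * (b + e) * (c + e) * (d + e)) =
    4 * (a ^ 3 + b ^ 3 + c ^ 3 + d ^ 3 + e ^ 3 + f ^ 3) * (f - e) + (a + b + c + d + e + f) * ((f - e) *
      (2 * (a + b + c + d + e + f) ^ 2 - 6 * (a ^ 2 + b ^ 2 + c ^ 2 + d ^ 2 + e ^ 2 + f ^ 2)
       + 12 * (e ^ 2 + f ^ 2)))"
  by (simp add: power2_eq_square power3_eq_cube algebra_simps)

text \<open>All 36 ordered pairs contribute 12 P_3 + 6 P_1 P_2 in terms of power sums; the six
  diagonal pairs take away 8 P_3.\<close>

lemma sum_pair_cubes: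
  fixes U :: "nat \<Rightarrow> 'a :: comm_ring_1"
  shows "(\<Sum>i<6. \<Sum>j<6. if i = j then 0 else (U i + U j) ^ 3) =
    4 * (\<Sum>i<6. U i ^ 3) + (\<Sum>i<6. U i) * (6 * (\<Sum>i<6. U i ^ 2))"
proof -
  have "(\<Sum>i<6. \<Sum>j<6. if i = j then 0 else (U i + U j) ^ 3) =
    (\<Sum>i<6. \<Sum>j<6. (U i + U j) ^ 3) - (\<Sum>i<6. \<Sum>j<6. if i = j then (U i + U j) ^ 3 else 0)"
    unfolding sum_subtractf[symmetric] by (intro sum.cong) auto
  also have "(\<Sum>i<6. \<Sum>j<6. if i = j then (U i + U j) ^ 3 else 0) = 8 * (\<Sum>i<6. U i ^ 3)"
    by (simp add: sum_distrib_left power3_eq_cube algebra_simps)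
  also have "(\<Sum>i<6. \<Sum>j<6. (U i + U j) ^ 3) =
     (\<Sum>i<6. \<Sum>j<6. U i ^ 3 + U j ^ 3 + 3 * (U i ^ 2 * U j) + 3 * (U i * U j ^ 2))"
    by (intro sum.cong refl) (simp add: power2_eq_square power3_eq_cube algebra_simps)
  also have "\<dots> = (\<Sum>i<6. \<Sum>j<6::nat. U i ^ 3) + (\<Sum>i<6::nat. \<Sum>j<6. U j ^ 3)
      + 3 * (\<Sum>i<6. \<Sum>j<6. U i ^ 2 * U j) + 3 * (\<Sum>i<6. \<Sum>j<6. U i * U j ^ 2)"
    by (simp only: sum.distrib sum_distrib_left)
  also have "\<dots> = 12 * (\<Sum>i<6. U i ^ 3) + 6 * ((\<Sum>i<6. U i) * (\<Sum>i<6. U i ^ 2))"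
    unfolding sum_product[symmetric] by (simp add: sum_distrib_left[symmetric])
  finally show ?thesis by (simp add: algebra_simps)
qed
lemma sum_lessThan_6_perm:
  assumes "distinct [i, j, k, l, m, n]" "{i, j, k, l, m, n} = {..<6::nat}"
  shows "sum f {..<6} = f i + f j + f k + f l + f m + (f n :: 'a :: comm_monoid_add)"
  unfolding assms(2)[symmetric] using assms(1) by (simp add: add.assoc)

lemma complement_duad:
  assumes "i < 6" "j < 6" "i \<noteq> (j::nat)"
  obtains k l m n where "distinct [i, j, k, l, m, n]" "{i, j, k, l, m, n} = {..<6}"
proof -
  have "card ({..<6} - {i, j}) = 4"
    using assms by (simp add: card_Diff_subset)
  then obtain xs where xs: "set xs = {..<6} - {i, j}" "distinct xs" "length xs = 4"
    by (metis distinct_card finite_Diff finite_distinct_list finite_lessThan)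
  then obtain k l m n where "xs = [k, l, m, n]"
    by (auto simp: numeral_eq_Suc length_Suc_conv)
  with xs have "{..<6} - {i, j} = {k, l, m, n}" "distinct [k, l, m, n]"
    by simp_all
  moreover from this have "{i, j, k, l, m, n} = {..<6}"
    using assms by (metis Diff_partition empty_subsetI insert_subset insert_is_Un lessThan_iff sup_assoc)
  ultimately show ?thesis
    using assms by (intro that[of k l m n]) auto
qed

context subring_ideal
begin

text \<open>The first two claims use only synthemes, on which the sum of \<open>l\<close> vanishes
  modulo \<open>J\<close>; the third uses only opposite triangles. The factor 4 stays because
  \<open>R\<close> is not assumed to contain fractions.\<close>

lemma
  assumes p: "duad_labelling p" "\<And>i j. p i j \<in> R" and q: "duad_labelling q" "\<And>i j. q i j \<in> R"
    and rel: "line_relations J p q"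
  defines "l \<equiv> \<lambda>i j. p i j - q i j" and "m \<equiv> \<lambda>i j. p i j + q i j"
  shows duad_split: "i < 6 \<Longrightarrow> j < 6 \<Longrightarrow> i \<noteq> j \<Longrightarrow> 4 * l i j \<approx> (\<Sum>k<6. l i k) + (\<Sum>k<6. l j k)"
    and duad_total: "(\<Sum>i<6. \<Sum>k<6. l i k) \<approx> 0"
    and star_const: "i < 6 \<Longrightarrow> j < 6 \<Longrightarrow> (\<Sum>k<6. m i k) \<approx> (\<Sum>k<6. m j k)"
proof -
  have psym: "p i j = p j i" and qsym: "q i j = q j i" and [simp]: "p i i = 0" "q i i = 0" for i j
    using p q by (auto simp: duad_labelling_def)
  have lR: "l i j \<in> R" and mR: "m i j \<in> R" for i j
    using p q by (auto simp: l_def m_def)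
  define S where "S = (\<lambda>i j k l m n. p i j + p k l + p m n - (q i j + q k l + q m n))"
  define T where "T = (\<lambda>i j k l m n. p i j + p j k + p i k - (q l m + q m n + q l n))"
  have ST: "S i j k l m n \<in> J" "T i j k l m n \<in> J"
    if "distinct [i, j, k, l, m, n]" "{i, j, k, l, m, n} = {..<6}" for i j k l m n
    using rel that unfolding line_relations_def S_def T_def by blast+
  have split: "4 * l i j \<approx> (\<Sum>k<6. l i k) + (\<Sum>k<6. l j k)" if ij: "i < 6" "j < 6" "i \<noteq> j" for i j
  proof -
    obtain a b c d where P: "distinct [i, j, a, b, c, d]" "{i, j, a, b, c, d} = {..<6}"
      using complement_duad[OF ij] .
    \<comment> \<open>With the other four elements split as ab|cd, these four synthemes cover every
      duad meeting ij in one element once, and ab and cd twice. Subtracting the syntheme ij|ab|cd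
      twice cancels ab and cd.\<close>
    have "S i a j b c d + S i b j a c d + S i c j d a b + S i d j c a b
        - (S i j a b c d + S i j a b c d) \<in> J"
      using P by (intro ideal_add ideal_diff ST) (simp_all add: insert_commute eq_commute)
    also have "S i a j b c d + S i b j a c d + S i c j d a b + S i d j c a b
        - (S i j a b c d + S i j a b c d) = (\<Sum>k<6. l i k) + (\<Sum>k<6. l j k) - 4 * l i j"
      unfolding sum_lessThan_6_perm[OF P] S_def l_def
      by (simp add: psym[of j i] qsym[of j i] algebra_simps)
    finally show ?thesis
      using lR ideal_uminus[of "(\<Sum>k<6. l i k) + (\<Sum>k<6. l j k) - 4 * l i j"]
      by (simp add: cong_def)
  qed
  then show "i < 6 \<Longrightarrow> j < 6 \<Longrightarrow> i \<noteq> j \<Longrightarrow> 4 * l i j \<approx> (\<Sum>k<6. l i k) + (\<Sum>k<6. l j k)" .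
  show "(\<Sum>i<6. \<Sum>k<6. l i k) \<approx> 0"
  proof -
    have P: "distinct [0, 1, 2, 3, 4, 5::nat]"
      by simp
    \<comment> \<open>The duads of one syntheme partition the six indices, so splitting each of them
      collects every star sum exactly once.\<close>
    have "(\<Sum>i<6. \<Sum>k<6. l i k) \<approx> 4 * l 0 1 + 4 * l 2 3 + 4 * l 4 5"
      using cong_sym[OF cong_add[OF cong_add[OF split[of 0 1] split[of 2 3]] split[of 4 5]]]
      by (simp add: sum_lessThan_6[of "\<lambda>i. \<Sum>k<6. l i k"] add.assoc)
    also have "4 * l 0 1 + 4 * l 2 3 + 4 * l 4 5 = S 0 1 2 3 4 5 * 4"
      by (simp add: S_def l_def algebra_simps)
    also have "S 0 1 2 3 4 5 * 4 \<approx> 0"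
      using ST[OF P lessThan_6] by (simp add: cong_0_iff ideal_mult)
    finally show ?thesis .
  qed
  show "(\<Sum>k<6. m i k) \<approx> (\<Sum>k<6. m j k)" if ij: "i < 6" "j < 6"
  proof (cases "i = j")
    case True
    then show ?thesis using mR by simp
  next
    case False
    obtain a b c d where P: "distinct [i, j, a, b, c, d]" "{i, j, a, b, c, d} = {..<6}"
      using complement_duad[OF ij False] .
    \<comment> \<open>Using a pair of opposite triangles with points and planes in both roles gives
      a relation in \<open>m\<close> alone. Subtracting the relation with i and j exchanged cancels
      ab and cd and leaves the two stars.\<close>
    have "(T i a b j c d - T j c d i a b) - (T j a b i c d - T i c d j a b) \<in> J"
      using P by (intro ideal_diff ST) (simp_all add: insert_commute eq_commute)
    also have "(T i a b j c d - T j c d i a b) - (T j a b i c d - T i c d j a b)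
        = (\<Sum>k<6. m i k) - (\<Sum>k<6. m j k)"
      unfolding sum_lessThan_6_perm[OF P] T_def m_def
      by (simp add: psym[of j i] qsym[of j i] algebra_simps)
    finally show ?thesis
      using mR by (simp add: cong_def)
  qed
qed

text \<open>The cubes of \<open>l\<close> are combinations of \<open>l * g\<close> and
  \<open>n * m\<close>. Both sums vanish for one reason: the first factor splits into star sums of
  total zero, while the second factor has the same sum on every star.\<close>

lemma sum_cubes_cong_0:
  assumes p: "duad_labelling p" "\<And>i j. p i j \<in> R" and q: "duad_labelling q" "\<And>i j. q i j \<in> R"
    and rel: "line_relations J p q" "line_relations J (\<lambda>i j. p i j ^ 2) (\<lambda>i j. q i j ^ 2)"
  defines "U \<equiv> \<lambda>i. \<Sum>k<6. p i k - q i k"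
  shows "4 * (\<Sum>i<6. U i ^ 3) \<approx> 0"
proof -
  define l where "l = (\<lambda>i j. p i j - q i j)"
  define m where "m = (\<lambda>i j. p i j + q i j)"
  define n where "n = (\<lambda>i j. p i j ^ 2 - q i j ^ 2)"
  define g where "g = (\<lambda>i j. p i j ^ 2 + q i j ^ 2)"
  define N where "N = (\<lambda>i. \<Sum>k<6. n i k)"
  define \<sigma> where "\<sigma> = (\<lambda>i. \<Sum>k<6. m i k)"
  define s where "s = (\<lambda>i. \<Sum>k<6. g i k)"
  have psym: "p i j = p j i" and qsym: "q i j = q j i" and diag: "p i i = 0" "q i i = 0" for i j
    using p q by (auto simp: duad_labelling_def)
  have sq: "duad_labelling (\<lambda>i j. p i j ^ 2)" "duad_labelling (\<lambda>i j. q i j ^ 2)"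
    using p q by (auto simp: duad_labelling_def)
  have R [simp]: "p i j \<in> R" "q i j \<in> R" "l i j \<in> R" "m i j \<in> R" "n i j \<in> R" "g i j \<in> R"
    "U i \<in> R" "N i \<in> R" "\<sigma> i \<in> R" "s i \<in> R" for i j
    using p q by (simp_all add: l_def m_def n_def g_def U_def N_def \<sigma>_def s_def)
  note lin = duad_split[OF p q rel(1)] duad_total[OF p q rel(1)] star_const[OF p q rel(1)]
  \<comment> \<open>The general statements are applied a second time, with squared labels.\<close>
  note quad = duad_split[OF sq(1) _ sq(2) _ rel(2)] duad_total[OF sq(1) _ sq(2) _ rel(2)]
    star_const[OF sq(1) _ sq(2) _ rel(2)]
  have l: "4 * l i j \<approx> U i + U j" if "i < 6" "j < 6" "i \<noteq> j" for i j
    using lin(1)[OF that] by (simp add: l_def U_def)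
  have n: "4 * n i j \<approx> N i + N j" if "i < 6" "j < 6" "i \<noteq> j" for i j
    using quad(1)[OF _ _ that] p(2) q(2) by (simp add: n_def N_def)
  have U0: "(\<Sum>i<6. U i) \<approx> 0" and N0: "(\<Sum>i<6. N i) \<approx> 0"
    using lin(2) quad(2) by (simp_all add: U_def N_def n_def)
  have \<sigma>: "\<sigma> i \<approx> \<sigma> 0" and s: "s i \<approx> s 0" if "i < 6" for i
    using lin(3)[of i 0] quad(3)[of i 0] that by (simp_all add: \<sigma>_def s_def m_def g_def)

  \<comment> \<open>Symmetry of \<open>b\<close> makes the two halves of the double sum equal, which
    turns a sum over pairs into a sum over stars.\<close>
  have pair_sum: "(\<Sum>i<6. \<Sum>j<6. (a i + a j) * b i j) = 2 * (\<Sum>i<6. a i * (\<Sum>j<6. b i j))"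
    if "\<And>i j. b i j = b j i" for a :: "nat \<Rightarrow> 'a" and b
  proof -
    have "(\<Sum>i<6::nat. \<Sum>j<6::nat. a j * b i j) = (\<Sum>i<6. \<Sum>j<6. a i * b i j)"
      by (subst sum.swap) (simp add: that)
    then show ?thesis
      by (simp add: distrib_right sum.distrib sum_distrib_left)
  qed
  have weighted: "(\<Sum>i<6. a i * b i) \<approx> 0"
    if "\<And>i. a i \<in> R" "\<And>i. i < 6 \<Longrightarrow> b i \<approx> b 0" "b 0 \<in> R" "(\<Sum>i<6. a i) \<approx> 0"
    for a b :: "nat \<Rightarrow> 'a"
  proof -
    have "(\<Sum>i<6. a i * b i) \<approx> (\<Sum>i<6. a i * b 0)"
      using that by (intro cong_sum cong_mult) auto
    also have "\<dots> = (\<Sum>i<6. a i) * b 0"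
      by (simp add: sum_distrib_right)
    also have "\<dots> \<approx> 0"
      using that by (intro cong_mult_0)
    finally show ?thesis .
  qed

  have "(\<Sum>i<6. \<Sum>j<6. 4 * l i j * g i j) \<approx> (\<Sum>i<6. \<Sum>j<6. (U i + U j) * g i j)"
  proof (intro cong_sum)
    fix i j assume "i \<in> {..<6::nat}" "j \<in> {..<6::nat}"
    then show "4 * l i j * g i j \<approx> (U i + U j) * g i j"
      using l[of i j] by (cases "i = j") (auto intro!: cong_mult simp: g_def diag)
  qed
  also have "\<dots> = 2 * (\<Sum>i<6. U i * s i)"
    unfolding s_def by (rule pair_sum) (simp add: g_def psym qsym)
  also have "\<dots> \<approx> 0"
    unfolding mult.commute[of 2] by (intro cong_mult_0 weighted s U0) simp_all
  finally have lg: "(\<Sum>i<6. \<Sum>j<6. 4 * l i j * g i j) \<approx> 0" .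

  have "(\<Sum>i<6. \<Sum>j<6. 4 * n i j * m i j) \<approx> (\<Sum>i<6. \<Sum>j<6. (N i + N j) * m i j)"
  proof (intro cong_sum)
    fix i j assume "i \<in> {..<6::nat}" "j \<in> {..<6::nat}"
    then show "4 * n i j * m i j \<approx> (N i + N j) * m i j"
      using n[of i j] by (cases "i = j") (auto intro!: cong_mult simp: m_def diag)
  qed
  also have "\<dots> = 2 * (\<Sum>i<6. N i * \<sigma> i)"
    unfolding \<sigma>_def by (rule pair_sum) (simp add: m_def psym qsym)
  also have "\<dots> \<approx> 0"
    unfolding mult.commute[of 2] by (intro cong_mult_0 weighted \<sigma> N0) simp_all
  finally have nm: "(\<Sum>i<6. \<Sum>j<6. 4 * n i j * m i j) \<approx> 0" .

  \<comment> \<open>A multiple of the vanishing sum of the \<open>U i\<close> is added to reach the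
    right side of \<open>sum_pair_cubes\<close>.\<close>
  have "4 * (\<Sum>i<6. U i ^ 3) \<approx> 4 * (\<Sum>i<6. U i ^ 3) + (\<Sum>i<6. U i) * (6 * (\<Sum>i<6. U i ^ 2))"
    using cong_add[OF cong_refl[of "4 * (\<Sum>i<6. U i ^ 3)"] cong_sym[OF cong_mult_0[OF U0, of "6 * (\<Sum>i<6. U i ^ 2)"]]]
    by simp
  also have "\<dots> = (\<Sum>i<6. \<Sum>j<6. if i = j then 0 else (U i + U j) ^ 3)"
    by (simp only: sum_pair_cubes)
  also have "\<dots> \<approx> (\<Sum>i<6. \<Sum>j<6. (4 * l i j) ^ 3)"
  proof (intro cong_sum)
    fix i j assume "i \<in> {..<6::nat}" "j \<in> {..<6::nat}"
    then show "(if i = j then 0 else (U i + U j) ^ 3) \<approx> (4 * l i j) ^ 3"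
      using l[of i j] by (cases "i = j") (auto intro!: cong_power intro: cong_sym simp: l_def diag)
  qed
  also have "\<dots> = (\<Sum>i<6. \<Sum>j<6. 32 * (4 * l i j * g i j) - 16 * (4 * n i j * m i j))"
    \<comment> \<open>$2 l (p^2 + q^2) = l^3 + l m^2$ and $l m = p^2 - q^2$\<close>
    by (intro sum.cong refl) (simp add: l_def m_def n_def g_def power2_eq_square power3_eq_cube algebra_simps)
  also have "\<dots> = 32 * (\<Sum>i<6. \<Sum>j<6. 4 * l i j * g i j) - 16 * (\<Sum>i<6. \<Sum>j<6. 4 * n i j * m i j)"
    by (simp only: sum_subtractf sum_distrib_left)
  also have "\<dots> \<approx> 32 * 0 - 16 * 0"
    by (intro cong_diff cong_mult lg nm) simp_all
  finally show ?thesis by simp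
qed

text \<open>The two products run over the stars of 5 and 4 without their common duad 45. The
  constant is 12 * 4^4: one factor 4 for each split label, and 12 from
  \<open>star_product_difference\<close>.\<close>

lemma star_quartic_cong_0:
  assumes p: "duad_labelling p" "\<And>i j. p i j \<in> R" and q: "duad_labelling q" "\<And>i j. q i j \<in> R"
    and rel: "line_relations J p q" "line_relations J (\<lambda>i j. p i j ^ 2) (\<lambda>i j. q i j ^ 2)"
  shows "3072 * ((\<Prod>i<4. p i 5 - q i 5) - (\<Prod>i<4. p i 4 - q i 4)) \<approx> 0"
proof -
  define l where "l = (\<lambda>i j. p i j - q i j)"
  define U where "U = (\<lambda>i. \<Sum>k<6. p i k - q i k)"
  define e1 where "e1 = (\<Sum>i<6. U i)"
  have R [simp]: "l i j \<in> R" "U i \<in> R" "e1 \<in> R" for i j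
    using p q by (simp_all add: l_def U_def e1_def)
  have U0: "e1 \<approx> 0"
    using duad_total[OF p q rel(1)] by (simp add: e1_def U_def)
  have U3: "4 * (\<Sum>i<6. U i ^ 3) \<approx> 0"
    unfolding U_def by (rule sum_cubes_cong_0[OF p q rel])
  have l: "4 * l i j \<approx> U i + U j" if "i < 6" "j < 6" "i \<noteq> j" for i j
    using duad_split[OF p q rel(1) that] by (simp add: l_def U_def)
  have quart: "256 * (\<Prod>i<4. l i j) \<approx> (\<Prod>i<4. U i + U j)" if "j = 4 \<or> j = 5" for j
  proof -
    have "256 * (\<Prod>i<4. l i j) = (4 * l 0 j) * (4 * l 1 j) * (4 * l 2 j) * (4 * l 3 j)"
      by (simp add: prod_lessThan_4)
    also have "\<dots> \<approx> (U 0 + U j) * (U 1 + U j) * (U 2 + U j) * (U 3 + U j)"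
      using that by (intro cong_mult l) auto
    also have "\<dots> = (\<Prod>i<4. U i + U j)"
      by (simp only: prod_lessThan_4)
    finally show ?thesis .
  qed
  have "3072 * ((\<Prod>i<4. l i 5) - (\<Prod>i<4. l i 4)) = 12 * (256 * (\<Prod>i<4. l i 5) - 256 * (\<Prod>i<4. l i 4))"
    by (simp add: algebra_simps)
  also have "\<dots> \<approx> 12 * ((\<Prod>i<4. U i + U 5) - (\<Prod>i<4. U i + U 4))"
    by (intro cong_mult cong_diff quart) simp_all
  also have "\<dots> = (4 * (\<Sum>i<6. U i ^ 3)) * (U 5 - U 4)
      + e1 * ((U 5 - U 4) * (2 * e1 ^ 2 - 6 * (\<Sum>i<6. U i ^ 2) + 12 * (U 4 ^ 2 + U 5 ^ 2)))"
    unfolding e1_def sum_lessThan_6 prod_lessThan_4 by (rule star_product_difference)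
  also have "\<dots> \<approx> 0 + 0"
    by (intro cong_add cong_mult_0 U0 U3) simp_all
  finally show ?thesis
    by (simp add: l_def)
qed

end

text \<open>Put P = c + e - f and Q = a - b - d. The linear relation is P + Q and its multiplier is
  P - Q. Moreover P^2 = c^2 + e^2 - f^2 + 2 (c - f) (e - f) and Q^2 = b^2 + d^2 - a^2 + 2 (a - b) (a
  - d), so twice the quadratic relation corrects P^2 - Q^2 to the difference of square sums.\<close>

lemma (in subring_ideal) square_relation:
  assumes R: "a \<in> R" "b \<in> R" "c \<in> R" "d \<in> R" "e \<in> R" "f \<in> R"
    and lin: "a + c + e - b - d - f \<in> J"
    and quad: "(a - b) * (a - d) - (c - f) * (e - f) \<in> J"
  shows "a ^ 2 + c ^ 2 + e ^ 2 - (b ^ 2 + d ^ 2 + f ^ 2) \<in> J"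
proof -
  have "(a + c + e - b - d - f) * (b + c + d + e - a - f)
      + ((a - b) * (a - d) - (c - f) * (e - f)) * 2 \<in> J"
    using R lin quad by (intro ideal_add ideal_mult) simp_all
  also have "(a + c + e - b - d - f) * (b + c + d + e - a - f)
      + ((a - b) * (a - d) - (c - f) * (e - f)) * 2 = a ^ 2 + c ^ 2 + e ^ 2 - (b ^ 2 + d ^ 2 + f ^ 2)"
    by (simp add: power2_eq_square algebra_simps)
  finally show ?thesis .
qed


section \<open>Orthogonal reflections\<close>

text \<open>These rules would turn sums over the two-element field into cardinalities.\<close>

declare add_bit_eq_xor [simp del] mult_bit_eq_and [simp del]

lemma bit_add_self [simp]: "b + b = (0 :: bit)"
  by (cases b) simp_all

text \<open>The alternating bilinear form that polarizes \<open>quad\<close>; see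
  \<open>quad_add\<close>.\<close>

definition polar :: "nat \<Rightarrow> bit vec \<Rightarrow> bit vec \<Rightarrow> bit" where
  "polar m v w = (\<Sum>i<m. v $ (2 * i) * w $ (2 * i + 1) + v $ (2 * i + 1) * w $ (2 * i))"

lemma polar_self [simp]: "polar m v v = 0"
  unfolding polar_def by (intro sum.neutral) (auto simp: mult.commute[of "v $ Suc _"])

lemma polar_smult:
  "v \<in> carrier_vec (2 * m) \<Longrightarrow> w \<in> carrier_vec (2 * m) \<Longrightarrow> polar m v (c \<cdot>\<^sub>v w) = c * polar m v w"
  unfolding polar_def sum_distrib_left by (cases c) auto

lemma polar_add_left:
  assumes "u \<in> carrier_vec (2 * m)" "v \<in> carrier_vec (2 * m)"
  shows "polar m (u + v) w = polar m u w + polar m v w"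
  unfolding polar_def sum.distrib[symmetric]
proof (rule sum.cong)
  fix i assume "i \<in> {..<m}"
  then have "(u + v) $ (2 * i) = u $ (2 * i) + v $ (2 * i)" "(u + v) $ (2 * i + 1) = u $ (2 * i + 1) + v $ (2 * i + 1)"
    using assms by simp_all
  then show "(u + v) $ (2 * i) * w $ (2 * i + 1) + (u + v) $ (2 * i + 1) * w $ (2 * i)
      = u $ (2 * i) * w $ (2 * i + 1) + u $ (2 * i + 1) * w $ (2 * i)
        + (v $ (2 * i) * w $ (2 * i + 1) + v $ (2 * i + 1) * w $ (2 * i))"
    by (simp add: algebra_simps)
qed simp

lemma polar_smult_left:
  "v \<in> carrier_vec (2 * m) \<Longrightarrow> polar m (c \<cdot>\<^sub>v v) w = c * polar m v w"
  unfolding polar_def sum_distrib_left by (cases c) auto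

lemma quad_add:
  assumes "v \<in> carrier_vec (2 * m)" "w \<in> carrier_vec (2 * m)"
  shows "quad m (v + w) = quad m v + quad m w + polar m v w"
  unfolding quad_def polar_def sum.distrib[symmetric]
proof (rule sum.cong)
  fix i assume "i \<in> {..<m}"
  then have "(v + w) $ (2 * i) = v $ (2 * i) + w $ (2 * i)" "(v + w) $ (2 * i + 1) = v $ (2 * i + 1) + w $ (2 * i + 1)"
    using assms by simp_all
  then show "(v + w) $ (2 * i) * (v + w) $ (2 * i + 1)
      = v $ (2 * i) * v $ (2 * i + 1) + w $ (2 * i) * w $ (2 * i + 1)
        + (v $ (2 * i) * w $ (2 * i + 1) + v $ (2 * i + 1) * w $ (2 * i))"
    by (simp add: algebra_simps)
qed simp

lemma quad_smult: "v \<in> carrier_vec (2 * m) \<Longrightarrow> quad m (c \<cdot>\<^sub>v v) = c * quad m v"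
  by (cases c) (simp_all add: quad_def)

lemma sum_lessThan_add: "(\<Sum>i<k + n::nat. f i) = (\<Sum>i<k. f i) + (\<Sum>i<n. f (k + i) :: 'a :: comm_monoid_add)"
  by (induction n) (simp_all add: add.assoc)

lemma quad_append:
  assumes "u \<in> carrier_vec (2 * k)" "w \<in> carrier_vec (2 * n)"
  shows "quad (k + n) (u @\<^sub>v w) = quad k u + quad n w"
  using assms by (simp add: quad_def sum_lessThan_add)

lemma polar_append:
  assumes "u \<in> carrier_vec (2 * k)" "w \<in> carrier_vec (2 * n)"
    and "u' \<in> carrier_vec (2 * k)" "w' \<in> carrier_vec (2 * n)"
  shows "polar (k + n) (u @\<^sub>v w) (u' @\<^sub>v w') = polar k u u' + polar n w w'"
  using assms by (simp add: polar_def sum_lessThan_add)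

text \<open>The matrix of the transvection v + B(v, a) a, where B is \<open>polar\<close>. Column j
  pairs with the other coordinate of its hyperbolic pair; the subtraction occurs only for odd j, so
  it never truncates.\<close>

definition reflection :: "nat \<Rightarrow> bit vec \<Rightarrow> bit mat" where
  "reflection m a = mat (2 * m) (2 * m)
     (\<lambda>(i, j). (if i = j then 1 else 0) + a $ i * a $ (if even j then j + 1 else j - 1))"

lemma reflection_carrier [simp]: "reflection m a \<in> carrier_mat (2 * m) (2 * m)"
  by (simp add: reflection_def)

lemma sum_lessThan_double: "(\<Sum>i<2 * m::nat. f i) = (\<Sum>i<m. f (2 * i) + f (2 * i + 1) :: 'a :: comm_monoid_add)"
  by (induction m) (simp_all add: add.assoc)

lemma reflection_mult:
  assumes v: "v \<in> carrier_vec (2 * m)" and a: "a \<in> carrier_vec (2 * m)"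
  shows "reflection m a *\<^sub>v v = v + polar m v a \<cdot>\<^sub>v a"
proof (rule eq_vecI)
  show "dim_vec (reflection m a *\<^sub>v v) = dim_vec (v + polar m v a \<cdot>\<^sub>v a)"
    using a by (simp add: reflection_def)
  fix i assume "i < dim_vec (v + polar m v a \<cdot>\<^sub>v a)"
  then have i: "i < 2 * m" using a by simp
  have "(reflection m a *\<^sub>v v) $ i =
      (\<Sum>j<2 * m. ((if i = j then 1 else 0) + a $ i * a $ (if even j then j + 1 else j - 1)) * v $ j)"
    using i v by (simp add: reflection_def scalar_prod_def atLeast0LessThan)
  also have "\<dots> = (\<Sum>j<2 * m. if i = j then v $ j else 0)
      + (\<Sum>j<2 * m. a $ i * (a $ (if even j then j + 1 else j - 1) * v $ j))"
    unfolding sum.distrib[symmetric] by (intro sum.cong) (auto simp: distrib_right mult.assoc)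
  also have "(\<Sum>j<2 * m. if i = j then v $ j else 0) = v $ i"
    using i by simp
  also have "(\<Sum>j<2 * m. a $ i * (a $ (if even j then j + 1 else j - 1) * v $ j)) = a $ i * polar m v a"
    unfolding sum_lessThan_double polar_def sum_distrib_left
    by (intro sum.cong) (simp_all add: distrib_left ac_simps)
  also have "v $ i + a $ i * polar m v a = (v + polar m v a \<cdot>\<^sub>v a) $ i"
    using i a v by (simp add: mult.commute)
  finally show "(reflection m a *\<^sub>v v) $ i = (v + polar m v a \<cdot>\<^sub>v a) $ i" .
qed

lemma mat_eq_one_if_fixes:
  fixes A :: "'a :: comm_ring_1 mat"
  assumes A: "A \<in> carrier_mat n n" and fix_v: "\<And>v. v \<in> carrier_vec n \<Longrightarrow> A *\<^sub>v v = v"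
  shows "A = 1\<^sub>m n"
proof (rule eq_matI)
  fix i j assume ij: "i < dim_row (1\<^sub>m n :: 'a mat)" "j < dim_col (1\<^sub>m n :: 'a mat)"
  then have "A $$ (i, j) = (A *\<^sub>v unit_vec n j) $ i"
    using A by simp
  also have "\<dots> = 1\<^sub>m n $$ (i, j)"
    using ij fix_v[of "unit_vec n j"] by simp
  finally show "A $$ (i, j) = 1\<^sub>m n $$ (i, j)" .
qed (use A in auto)

text \<open>With t = B(v, a) and q(a) = 1, the form changes by t^2 + t^2 = 0. The map is an
  involution because B(a, a) = 0, so it is its own inverse.\<close>

lemma reflection_orthogonal:
  assumes a: "a \<in> carrier_vec (2 * m)" "quad m a = 1"
  shows "reflection m a \<in> orthogonal_group m"
proof -
  have quad: "quad m (reflection m a *\<^sub>v v) = quad m v" if "v \<in> carrier_vec (2 * m)" for v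
    using that a by (cases "polar m v a") (simp_all add: reflection_mult quad_add quad_smult polar_smult)
  have "reflection m a * reflection m a = 1\<^sub>m (2 * m)"
  proof (rule mat_eq_one_if_fixes)
    fix v :: "bit vec" assume v: "v \<in> carrier_vec (2 * m)"
    have "(reflection m a * reflection m a) *\<^sub>v v = reflection m a *\<^sub>v (v + polar m v a \<cdot>\<^sub>v a)"
      using v a by (subst assoc_mult_mat_vec[of _ "2 * m" "2 * m"]) (simp_all add: reflection_mult)
    also have "\<dots> = (v + polar m v a \<cdot>\<^sub>v a) + polar m v a \<cdot>\<^sub>v a"
      using v a by (simp add: reflection_mult polar_add_left polar_smult_left)
    also have "\<dots> = v"
      using v a by (intro eq_vecI) (simp_all add: add.assoc)
    finally show "(reflection m a * reflection m a) *\<^sub>v v = v" .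
  qed (rule mult_carrier_mat[OF reflection_carrier reflection_carrier])
  then have "invertible_mat (reflection m a)"
    by (auto simp: invertible_mat_def inverts_mat_def reflection_def)
  with quad show ?thesis
    by (simp add: orthogonal_group_def)
qed

lemma one_orthogonal: "1\<^sub>m (2 * m) \<in> orthogonal_group m"
  by (auto simp: orthogonal_group_def invertible_mat_def inverts_mat_def intro!: exI[of _ "1\<^sub>m (2 * m)"])

lemma invertible_mat_mult:
  assumes A: "A \<in> carrier_mat n n" "invertible_mat A" and B: "B \<in> carrier_mat n n" "invertible_mat B"
  shows "invertible_mat (A * B)"
proof -
  obtain A' B' where A': "A * A' = 1\<^sub>m n" "A' * A = 1\<^sub>m (dim_row A')"
    and B': "B * B' = 1\<^sub>m n" "B' * B = 1\<^sub>m (dim_row B')"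
    using A B by (auto simp: invertible_mat_def inverts_mat_def)
  \<comment> \<open>\<open>invertible_mat\<close> does not fix the size of the inverse; it is read
    off from the dimensions of the two products.\<close>
  have c: "A' \<in> carrier_mat n n" "B' \<in> carrier_mat n n"
    using arg_cong[OF A'(1), of dim_col] arg_cong[OF A'(2), of dim_col]
      arg_cong[OF B'(1), of dim_col] arg_cong[OF B'(2), of dim_col] A(1) B(1) by auto
  have "(A * B) * (B' * A') = A * ((B * B') * A')"
    using A(1) B(1) c by (simp add: assoc_mult_mat[of _ n n _ n _ n])
  moreover have "(B' * A') * (A * B) = B' * ((A' * A) * B)"
    using A(1) B(1) c by (simp add: assoc_mult_mat[of _ n n _ n _ n])
  ultimately have "inverts_mat (A * B) (B' * A')" "inverts_mat (B' * A') (A * B)"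
    using A(1) B(1) A' B' c by (simp_all add: inverts_mat_def)
  then show ?thesis
    using A(1) B(1) by (auto simp: invertible_mat_def)
qed

lemma mult_orthogonal:
  assumes "g \<in> orthogonal_group m" "h \<in> orthogonal_group m"
  shows "g * h \<in> orthogonal_group m"
proof -
  have "invertible_mat (g * h)"
    using assms by (auto simp: orthogonal_group_def intro: invertible_mat_mult)
  then show ?thesis
    using assms by (auto simp: orthogonal_group_def assoc_mult_mat_vec[of _ "2 * m" "2 * m"])
qed

lemma append_vec_assoc: "(u @\<^sub>v v) @\<^sub>v w = u @\<^sub>v (v @\<^sub>v w)"
  by (intro eq_vecI) auto

lemma vec_of_list_append: "vec_of_list (xs @ ys) = vec_of_list xs @\<^sub>v vec_of_list ys"
  by (metis list_of_vec_append list_vec vec_list)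

text \<open>Padding each vector with zeros makes its reflection trivial on the first summand, so
  computations in dimension 2n serve for every k.\<close>

lemma reflections_orthogonal:
  assumes "set as \<subseteq> carrier_vec (2 * n)" "\<forall>a \<in> set as. quad n a = 1"
  shows "\<exists>g \<in> orthogonal_group (k + n). \<forall>u \<in> carrier_vec (2 * k). \<forall>w \<in> carrier_vec (2 * n).
    g *\<^sub>v (u @\<^sub>v w) = u @\<^sub>v fold (\<lambda>a w. w + polar n w a \<cdot>\<^sub>v a) as w"
  using assms
proof (induction as)
  case Nil
  have "\<forall>u \<in> carrier_vec (2 * k). \<forall>w \<in> carrier_vec (2 * n). 1\<^sub>m (2 * (k + n)) *\<^sub>v (u @\<^sub>v w) = u @\<^sub>v (w :: bit vec)"
    by (auto intro!: one_mult_mat_vec carrier_vecI)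
  then show ?case
    using one_orthogonal[of "k + n"] by (intro bexI[of _ "1\<^sub>m (2 * (k + n))"]) simp_all
next
  case (Cons a as)
  then obtain g where g: "g \<in> orthogonal_group (k + n)" "\<forall>u \<in> carrier_vec (2 * k). \<forall>w \<in> carrier_vec (2 * n).
      g *\<^sub>v (u @\<^sub>v w) = u @\<^sub>v fold (\<lambda>a w. w + polar n w a \<cdot>\<^sub>v a) as w"
    by auto
  define a' where "a' = 0\<^sub>v (2 * k) @\<^sub>v a"
  have a: "a \<in> carrier_vec (2 * n)" "quad n a = 1"
    using Cons.prems by auto
  have zero: "quad k (0\<^sub>v (2 * k)) = 0" "polar k u (0\<^sub>v (2 * k)) = 0" for u
    by (simp_all add: quad_def polar_def)
  have a': "a' \<in> carrier_vec (2 * (k + n))" "quad (k + n) a' = 1"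
    using a by (auto simp: a'_def quad_append zero intro!: carrier_vecI)
  \<comment> \<open>The new reflection is the right factor because \<open>fold\<close> applies the
    head of the list first.\<close>
  have "(g * reflection (k + n) a') *\<^sub>v (u @\<^sub>v w)
      = u @\<^sub>v fold (\<lambda>a w. w + polar n w a \<cdot>\<^sub>v a) (a # as) w"
    if u: "u \<in> carrier_vec (2 * k)" and w: "w \<in> carrier_vec (2 * n)" for u w
  proof -
    have uw: "u @\<^sub>v w \<in> carrier_vec (2 * (k + n))"
      using u w by (auto intro!: carrier_vecI)
    have "reflection (k + n) a' *\<^sub>v (u @\<^sub>v w) = (u @\<^sub>v w) + polar n w a \<cdot>\<^sub>v a'"
      using reflection_mult[OF uw a'(1)] u w a by (simp add: a'_def polar_append zero)
    also have "\<dots> = u @\<^sub>v (w + polar n w a \<cdot>\<^sub>v a)"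
      using u w a by (intro eq_vecI) (auto simp: a'_def)
    finally have "(g * reflection (k + n) a') *\<^sub>v (u @\<^sub>v w) = g *\<^sub>v (u @\<^sub>v (w + polar n w a \<cdot>\<^sub>v a))"
      using g(1) uw reflection_carrier[of "k + n" a'] by (subst assoc_mult_mat_vec[of _ "2 * (k + n)" "2 * (k + n)"])
        (auto simp: orthogonal_group_def)
    then show ?thesis
      using g(2) u w a by simp
  qed
  then show ?case
    using mult_orthogonal[OF g(1) reflection_orthogonal[OF a']] by blast
qed

section \<open>Evaluation of forms, reflections and spans on bit lists\<close>

fun quad_list :: "bit list \<Rightarrow> bit" where
  "quad_list (x # y # xs) = x * y + quad_list xs"
| "quad_list _ = 0"

fun polar_list :: "bit list \<Rightarrow> bit list \<Rightarrow> bit" where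
  "polar_list (x # y # xs) (x' # y' # ys) = x * y' + y * x' + polar_list xs ys"
| "polar_list _ _ = 0"

definition reflect_list :: "bit list \<Rightarrow> bit list \<Rightarrow> bit list" where
  "reflect_list a v = (if polar_list v a = 0 then v else map2 (+) v a)"

text \<open>Over the two-element field a span consists of the subset sums of its generators, so it
  becomes a finite list open to evaluation.\<close>

fun combos :: "nat \<Rightarrow> bit list list \<Rightarrow> bit list list" where
  "combos n [] = [replicate n 0]"
| "combos n (b # bs) = combos n bs @ map (map2 (+) b) (combos n bs)"

lemma quad_vec_of_list: "length xs = 2 * n \<Longrightarrow> quad n (vec_of_list xs) = quad_list xs"
proof (induction n arbitrary: xs)
  case (Suc n)
  then obtain x y zs where "xs = x # y # zs" "length zs = 2 * n"
    by (auto simp: length_Suc_conv)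
  with Suc.IH[of zs] show ?case
    by (simp add: quad_def sum.lessThan_Suc_shift vec_of_list_index del: sum.lessThan_Suc vec_of_list_Cons)
qed (simp add: quad_def)

lemma polar_vec_of_list:
  "length xs = 2 * n \<Longrightarrow> length ys = 2 * n \<Longrightarrow> polar n (vec_of_list xs) (vec_of_list ys) = polar_list xs ys"
proof (induction n arbitrary: xs ys)
  case (Suc n)
  then obtain x y zs x' y' zs' where "xs = x # y # zs" "length zs = 2 * n" "ys = x' # y' # zs'" "length zs' = 2 * n"
    by (auto simp: length_Suc_conv)
  with Suc.IH[of zs zs'] show ?case
    by (simp add: polar_def sum.lessThan_Suc_shift vec_of_list_index del: sum.lessThan_Suc vec_of_list_Cons)
qed (simp add: polar_def)

lemma vec_of_list_map2_add:
  "length xs = length ys \<Longrightarrow> vec_of_list (map2 (+) xs ys) = vec_of_list xs + vec_of_list (ys :: bit list)"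
  by (intro eq_vecI) (simp_all add: vec_of_list_index del: vec_of_list_map)

lemma vec_of_list_reflect_list:
  assumes "length v = 2 * n" "length a = 2 * n"
  shows "vec_of_list (reflect_list a v) =
    vec_of_list v + polar n (vec_of_list v) (vec_of_list a) \<cdot>\<^sub>v vec_of_list a"
proof (cases "polar_list v a = 0")
  case True
  then show ?thesis
    using assms by (intro eq_vecI) (simp_all add: reflect_list_def polar_vec_of_list vec_of_list_index)
next
  case False
  then show ?thesis
    using assms by (simp add: reflect_list_def polar_vec_of_list vec_of_list_map2_add del: vec_of_list_map)
qed

lemma length_reflect_list [simp]: "length v = length a \<Longrightarrow> length (reflect_list a v) = length a"
  by (simp add: reflect_list_def)

lemma fold_vec_of_list:
  assumes "length v = 2 * n" "\<forall>a \<in> set as. length a = 2 * n"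
  shows "fold (\<lambda>a w. w + polar n w a \<cdot>\<^sub>v a) (map vec_of_list as) (vec_of_list v)
    = vec_of_list (fold reflect_list as v)"
  using assms by (induction as arbitrary: v) (simp_all add: vec_of_list_reflect_list[symmetric])

lemma length_combos: "\<forall>b \<in> set bs. length b = n \<Longrightarrow> xs \<in> set (combos n bs) \<Longrightarrow> length xs = n"
  by (induction bs arbitrary: xs) auto

text \<open>The detour through \<open>span_list\<close> allows induction on the generators: as the
  scalars are only 0 and 1, a new generator b adds just the translate by b.\<close>

lemma list_span_eq:
  assumes "\<forall>b \<in> set bs. length b = n"
  shows "list_span n bs = vec_of_list ` set (combos n bs)"
proof -
  interpret vec_space "TYPE(bit)" n .
  have "span_list (map vec_of_list bs) = vec_of_list ` set (combos n bs)"
    using assms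
  proof (induction bs)
    case Nil
    have "vec_of_list (replicate n 0) = (0\<^sub>v n :: bit vec)"
      by (intro eq_vecI) (simp_all add: vec_of_list_index)
    then show ?case
      by (auto simp: span_list_def)
  next
    case (Cons b bs)
    let ?S = "span_list (map vec_of_list bs)"
    have b: "vec_of_list b \<in> carrier_vec n"
      using Cons.prems by (auto intro!: carrier_vecI)
    have S: "?S \<subseteq> carrier_vec n"
      using Cons length_combos[of bs n] by (auto intro!: carrier_vecI)
    have "span_list (map vec_of_list (b # bs)) = {c \<cdot>\<^sub>v vec_of_list b + v | c v. v \<in> ?S}"
    proof (intro equalityI subsetI)
      fix v assume "v \<in> span_list (map vec_of_list (b # bs))"
      then show "v \<in> {c \<cdot>\<^sub>v vec_of_list b + v | c v. v \<in> ?S}"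
        by (auto simp: span_list_def simp del: vec_of_list_Cons)
    next
      fix v assume "v \<in> {c \<cdot>\<^sub>v vec_of_list b + v | c v. v \<in> ?S}"
      then obtain c f where "v = c \<cdot>\<^sub>v vec_of_list b + lincomb_list f (map vec_of_list bs)"
        by (auto simp: span_list_def)
      then have "v = lincomb_list (case_nat c f) (map vec_of_list (b # bs))"
        by (simp add: comp_def)
      then show "v \<in> span_list (map vec_of_list (b # bs))"
        unfolding span_list_def by blast
    qed
    also have "\<dots> = ?S \<union> (\<lambda>v. vec_of_list b + v) ` ?S"
    proof (intro equalityI subsetI)
      fix v assume "v \<in> {c \<cdot>\<^sub>v vec_of_list b + v | c v. v \<in> ?S}"
      then obtain c w where v: "v = c \<cdot>\<^sub>v vec_of_list b + w" "w \<in> ?S" by blast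
      with S b show "v \<in> ?S \<union> (\<lambda>v. vec_of_list b + v) ` ?S"
        by (cases c) auto
    next
      fix v assume "v \<in> ?S \<union> (\<lambda>v. vec_of_list b + v) ` ?S"
      then consider "v \<in> ?S" | w where "v = vec_of_list b + w" "w \<in> ?S" by blast
      then show "v \<in> {c \<cdot>\<^sub>v vec_of_list b + v | c v. v \<in> ?S}"
      proof cases
        case 1
        then have "v = 0 \<cdot>\<^sub>v vec_of_list b + v" using S b by auto
        with 1 show ?thesis by blast
      next
        case 2
        then have "v = 1 \<cdot>\<^sub>v vec_of_list b + w" using b by simp
        with 2 show ?thesis by blast
      qed
    qed
    also have "\<dots> = vec_of_list ` set (combos n (b # bs))"
    proof -
      have "vec_of_list b + vec_of_list xs = vec_of_list (map2 (+) b xs)" if "xs \<in> set (combos n bs)" for xs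
        using length_combos[OF _ that] Cons.prems by (simp add: vec_of_list_map2_add del: vec_of_list_map)
      then have "(\<lambda>v. vec_of_list b + v) ` vec_of_list ` set (combos n bs)
          = vec_of_list ` map2 (+) b ` set (combos n bs)"
        by (simp add: image_image del: vec_of_list_map)
      with Cons show ?thesis
        by (simp add: image_Un del: vec_of_list_map)
    qed
    finally show ?case .
  qed
  moreover have "set (map vec_of_list bs) \<subseteq> carrier_vec n"
    using assms by (auto intro!: carrier_vecI)
  ultimately show ?thesis
    unfolding list_span_def by (simp only: span_list_as_span)
qed

section \<open>Maximality of the isotropic sums\<close>

lemma std_isotropic_add:
  "u \<in> std_isotropic k \<Longrightarrow> v \<in> std_isotropic k \<Longrightarrow> u + v \<in> std_isotropic k"
  by (auto simp: std_isotropic_def)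

lemma list_span_add:
  assumes "\<forall>b \<in> set bs. length b = n" "v \<in> list_span n bs" "w \<in> list_span n bs"
  shows "v + w \<in> list_span n bs"
proof -
  interpret vec_space "TYPE(bit)" n .
  have "set (map vec_of_list bs) \<subseteq> carrier_vec n"
    using assms by (auto intro!: carrier_vecI)
  then show ?thesis
    using assms(2,3) unfolding list_span_def by (rule span_add1)
qed

text \<open>Maximality comes from self-orthogonality instead of a dimension count: an isotropic
  space containing \<open>?W\<close> is orthogonal to \<open>?W\<close>, and both summands contain
  their own orthogonal complements. For the second summand this is \<open>perp\<close>, which can be
  checked by enumeration.\<close>

lemma max_totally_isotropic_dsum:
  assumes len: "\<forall>b \<in> set bs. length b = 2 * n"
    and iso: "\<forall>xs \<in> set (combos (2 * n) bs). quad_list xs = 0"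
    and perp: "\<And>xs. length xs = 2 * n \<Longrightarrow> \<forall>b \<in> set (combos (2 * n) bs). polar_list xs b = 0 \<Longrightarrow> xs \<in> set (combos (2 * n) bs)"
  shows "max_totally_isotropic (k + n) (dsum (std_isotropic k) (list_span (2 * n) bs))"
    (is "max_totally_isotropic _ ?W")
proof -
  let ?Y = "list_span (2 * n) bs"
  note Y = list_span_eq[OF len]
  have std: "u \<in> carrier_vec (2 * k)" "quad k u = 0" if "u \<in> std_isotropic k" for u
    using that by (simp_all add: std_isotropic_def quad_def)
  have Yc: "w \<in> carrier_vec (2 * n)" "quad n w = 0" if "w \<in> ?Y" for w
    using that length_combos[OF len] iso by (auto simp: Y quad_vec_of_list intro!: carrier_vecI)
  have carrier: "v \<in> carrier_vec (2 * (k + n))" if "v \<in> ?W" for v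
    using that std(1) Yc(1) by (fastforce simp: dsum_def intro!: carrier_vecI)
  have add: "v + w \<in> ?W" if "v \<in> ?W" "w \<in> ?W" for v w
  proof -
    obtain a b c d where "v = a @\<^sub>v b" "w = c @\<^sub>v d"
      "a \<in> std_isotropic k" "c \<in> std_isotropic k" "b \<in> ?Y" "d \<in> ?Y"
      using \<open>v \<in> ?W\<close> \<open>w \<in> ?W\<close> by (auto simp: dsum_def)
    then have "v + w = (a + c) @\<^sub>v (b + d)" "a + c \<in> std_isotropic k" "b + d \<in> ?Y"
      using std_isotropic_add list_span_add[OF len] std(1) Yc(1)
      by (auto simp: append_vec_add[of _ "2 * k" _ _ "2 * n"])
    then show ?thesis
      unfolding dsum_def by blast
  qed
  have zero_std: "0\<^sub>v (2 * k) \<in> std_isotropic k" and zero_Y: "0\<^sub>v (2 * n) \<in> ?Y"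
  proof -
    show "0\<^sub>v (2 * k) \<in> std_isotropic k"
      by (simp add: std_isotropic_def)
    interpret V: vec_space "TYPE(bit)" "2 * n" .
    show "0\<^sub>v (2 * n) \<in> ?Y"
      unfolding list_span_def using len by (intro V.span_zero)
  qed
  have zero: "0\<^sub>v (2 * (k + n)) \<in> ?W"
  proof -
    have "0\<^sub>v (2 * (k + n)) = 0\<^sub>v (2 * k) @\<^sub>v (0\<^sub>v (2 * n) :: bit vec)"
      by (intro eq_vecI) auto
    with zero_std zero_Y show ?thesis
      unfolding dsum_def by blast
  qed
  have smult: "c \<cdot>\<^sub>v v \<in> ?W" if "v \<in> ?W" for c v
  proof (cases "c = 0")
    case True
    then have "c \<cdot>\<^sub>v v = 0\<^sub>v (2 * (k + n))"
      using carrier[OF that] by (intro eq_vecI) auto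
    with zero show ?thesis by simp
  next
    case False
    with that show ?thesis by simp
  qed
  have "submodule class_ring ?W (F2_space (2 * (k + n)))"
    using carrier add zero smult
    by (intro submodule.intro vec_module) (auto simp: module_vec_simps simp del: distrib_left_numeral)
  then have sub: "VectorSpace.subspace class_ring ?W (F2_space (2 * (k + n)))"
    by (intro subspace.intro vec_vs)
  have "quad (k + n) v = 0" if "v \<in> ?W" for v
    using that std Yc by (auto simp: dsum_def quad_append)
  with sub have iso_W: "totally_isotropic (k + n) ?W"
    by (simp add: totally_isotropic_def)
  have "W' = ?W" if W': "totally_isotropic (k + n) W'" "?W \<subseteq> W'" for W'
  proof
    interpret submodule class_ring W' "F2_space (2 * (k + n))"
      using W'(1) by (simp add: totally_isotropic_def subspace_def)
    have W'c: "v \<in> carrier_vec (2 * (k + n))" if "v \<in> W'" for v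
      using subset that by (auto simp: module_vec_simps)
    have W'q: "quad (k + n) v = 0" if "v \<in> W'" for v
      using W'(1) that by (simp add: totally_isotropic_def)
    have W'add: "v + w \<in> W'" if "v \<in> W'" "w \<in> W'" for v w
      using m_closed[OF that] by (simp add: module_vec_simps)
    show "W' \<subseteq> ?W"
    proof
      fix v assume v: "v \<in> W'"
      \<comment> \<open>Polarization: v, w and v + w all lie in the isotropic space
        \<open>W'\<close>.\<close>
      have orth: "polar (k + n) v w = 0" if "w \<in> ?W" for w
      proof -
        have "quad (k + n) (v + w) = 0" "quad (k + n) v = 0" "quad (k + n) w = 0"
          using v that W' W'q W'add by auto
        then show ?thesis
          using quad_add[OF W'c[OF v], of w] carrier[OF that] by simp
      qed
      define u w where "u = vec_first v (2 * k)" and "w = vec_last v (2 * n)"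
      have uw: "u \<in> carrier_vec (2 * k)" "w \<in> carrier_vec (2 * n)" and v_eq: "v = u @\<^sub>v w"
        using W'c[OF v] by (simp_all add: u_def w_def)
      \<comment> \<open>Pairing with the unit vector at position 2i, which belongs to the standard
        isotropic space, reads off the entry at 2i + 1.\<close>
      have "u $ (2 * i + 1) = 0" if "i < k" for i
      proof -
        have e: "unit_vec (2 * k) (2 * i) \<in> std_isotropic k"
          using that by (auto simp: std_isotropic_def) presburger
        then have "unit_vec (2 * k) (2 * i) @\<^sub>v 0\<^sub>v (2 * n) \<in> ?W"
          using zero_Y by (auto simp: dsum_def)
        from orth[OF this] have "polar k u (unit_vec (2 * k) (2 * i)) + polar n w (0\<^sub>v (2 * n)) = 0"
          using uw by (simp add: v_eq polar_append)
        moreover have "polar n w (0\<^sub>v (2 * n)) = 0"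
          by (simp add: polar_def)
        moreover have "polar k u (unit_vec (2 * k) (2 * i)) = (\<Sum>j<k. if j = i then u $ (2 * j + 1) else 0)"
          unfolding polar_def
        proof (rule sum.cong)
          fix j assume "j \<in> {..<k}"
          moreover have "2 * j + 1 \<noteq> 2 * i" by presburger
          ultimately show "u $ (2 * j) * unit_vec (2 * k) (2 * i) $ (2 * j + 1)
              + u $ (2 * j + 1) * unit_vec (2 * k) (2 * i) $ (2 * j) = (if j = i then u $ (2 * j + 1) else 0)"
            using that by simp
        qed simp
        ultimately show ?thesis
          using that by simp
      qed
      then have "u \<in> std_isotropic k"
        using uw by (simp add: std_isotropic_def)
      moreover have "w \<in> ?Y"
      proof -
        define xs where "xs = list_of_vec w"
        have xs: "length xs = 2 * n" "w = vec_of_list xs"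
          using uw by (auto simp: xs_def vec_list)
        have "polar_list xs b = 0" if "b \<in> set (combos (2 * n) bs)" for b
        proof -
          have "0\<^sub>v (2 * k) @\<^sub>v vec_of_list b \<in> ?W"
            using zero_std that by (auto simp: dsum_def Y)
          moreover have "vec_of_list b \<in> carrier_vec (2 * n)"
            using length_combos[OF len that] by (auto intro!: carrier_vecI)
          ultimately have "polar k u (0\<^sub>v (2 * k)) + polar n w (vec_of_list b) = 0"
            using orth uw polar_append[of u k w n "0\<^sub>v (2 * k)" "vec_of_list b"] by (simp add: v_eq)
          moreover have "polar k u (0\<^sub>v (2 * k)) = 0"
            by (simp add: polar_def)
          ultimately show ?thesis
            using xs length_combos[OF len that] by (simp add: polar_vec_of_list)
        qed
        then show ?thesis
          using perp xs by (auto simp: Y)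
      qed
      ultimately show "v \<in> ?W"
        by (auto simp: v_eq dsum_def)
    qed
  qed fact
  with iso_W show ?thesis
    unfolding max_totally_isotropic_def by blast
qed

definition bit_lists :: "nat \<Rightarrow> bit list list" where
  "bit_lists n = List.n_lists n [0, 1]"

lemma set_bit_lists: "set (bit_lists n) = {xs. length xs = n}"
proof -
  have "set xs \<subseteq> {0, 1}" for xs :: "bit list"
    by (metis bit_not_one_iff insertCI subsetI)
  then show ?thesis
    by (auto simp: bit_lists_def set_n_lists)
qed

section \<open>The thirty spaces\<close>

text \<open>The last conjunct is self-orthogonality, tested on all 64 vectors; with isotropy it
  supplies the hypotheses of \<open>max_totally_isotropic_dsum\<close>.\<close>

lemma Y_bases_check:
  "\<forall>bs \<in> set Y_bases. (\<forall>b \<in> set bs. length b = 6) \<and>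
    (let W = combos 6 bs in (\<forall>xs \<in> set W. quad_list xs = 0) \<and>
      (\<forall>xs \<in> set (bit_lists 6). (\<forall>b \<in> set W. polar_list xs b = 0) \<longrightarrow> xs \<in> set W))"
  by code_simp

text \<open>The spaces $I_j$ for $m = 3$.\<close>

definition C_bases :: "bit list list list" where
  "C_bases = map (\<lambda>bs. [1, 0, 0, 0, 0, 0] # map ((@) [0, 0]) bs) B_bases"

text \<open>
  One row for each singular vector $v$: reflections whose product maps $(1, 0, 0, 0, 0, 0)$, which lies
  in all $I_j$, to $v$, and the numbers of the spaces to which it maps $I_1, \dots, I_6$. The number of
  reflections is odd, so that $I_1, I_3, I_5$ always go to points.
\<close>

definition reflection_table :: "(bit list list \<times> nat list) list" where
  "reflection_table = [
    ([[0,0,0,0,1,1], [0,1,0,0,1,1], [1,1,0,0,1,0]], [4,3,1,2,6,5]),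
    ([[0,0,0,0,1,1], [0,1,0,0,1,1], [1,1,0,0,0,1]], [9,10,8,7,11,12]),
    ([[0,0,0,0,1,1], [0,1,1,0,1,1], [1,1,1,1,1,1]], [14,13,8,2,1,7]),
    ([[0,0,0,0,1,1], [0,1,0,0,1,1], [1,1,0,1,1,0]], [18,17,1,2,16,15]),
    ([[0,0,0,0,1,1], [0,1,0,0,1,1], [1,1,0,1,0,1]], [21,22,8,7,19,20]),
    ([[0,0,0,0,1,1], [0,1,0,1,1,1], [1,1,1,1,1,1]], [4,10,23,24,9,3]),
    ([[0,0,0,0,1,1], [0,1,0,0,1,1], [1,1,1,0,1,0]], [4,3,25,26,19,20]),
    ([[0,0,0,0,1,1], [0,1,0,0,1,1], [1,1,1,0,0,1]], [9,10,28,27,16,15]),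
    ([[0,0,0,0,1,1], [0,1,0,1,1,1], [1,1,1,0,0,0]], [19,15,29,30,16,20]),
    ([[1,1,0,0,0,0]], [9,3,1,7,19,15]),
    ([[1,1,0,0,0,1]], [23,3,1,13,25,17]),
    ([[1,1,0,0,1,0]], [9,24,14,7,21,27]),
    ([[1,1,0,1,0,0]], [11,5,1,7,21,17]),
    ([[1,1,0,1,0,1]], [28,5,1,13,29,15]),
    ([[1,1,0,1,1,0]], [11,26,14,7,19,30]),
    ([[1,1,1,0,0,0]], [9,3,6,12,25,27]),
    ([[1,1,1,0,0,1]], [23,3,6,22,19,30]),
    ([[1,1,1,0,1,0]], [9,24,18,12,29,15]),
    ([[1,1,1,1,1,1]], [28,26,18,22,19,15]),
    ([[0,0,0,0,1,1]], [4,10,8,2,16,20]),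
    ([[0,0,0,0,1,1], [0,1,1,1,0,0], [0,1,1,1,0,1]], [4,26,18,2,14,24]),
    ([[0,0,0,0,1,1], [0,1,1,1,0,0], [0,1,1,1,1,0]], [28,10,8,22,23,13]),
    ([[0,0,0,0,1,1], [0,1,0,0,1,1], [0,1,0,1,1,1]], [18,22,8,2,6,12]),
    ([[0,0,0,0,1,1], [0,1,1,0,1,1], [0,1,1,1,1,0]], [14,30,6,2,16,27]),
    ([[0,0,0,0,1,1], [0,1,1,0,1,1], [0,1,1,1,0,1]], [29,13,8,12,25,20]),
    ([[0,0,0,0,1,1], [0,1,0,0,1,1], [0,1,1,0,1,1]], [4,10,28,26,11,5]),
    ([[0,0,0,0,1,1], [0,1,0,1,1,1], [0,1,1,1,1,0]], [4,5,29,24,21,20]),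
    ([[0,0,0,0,1,1], [0,1,0,1,1,1], [0,1,1,1,0,1]], [11,10,23,30,16,17]),
    ([[0,0,0,0,1,1], [0,1,0,0,1,1], [0,1,1,1,0,0]], [21,17,25,27,16,20]),
    ([[0,1,0,0,1,1]], [23,24,14,13,29,30]),
    ([[0,1,0,1,1,1]], [28,26,14,13,25,27]),
    ([[0,1,1,0,1,1]], [23,24,18,22,21,17]),
    ([[0,1,1,1,0,0]], [11,5,6,12,29,30]),
    ([[0,1,1,1,0,1]], [28,5,6,22,21,27]),
    ([[0,1,1,1,1,0]], [11,26,18,12,25,17])]"

text \<open>Spaces are compared through all their eight vectors, since the image of a listed basis
  need not be the listed basis of the image.\<close>

lemma reflection_table_check:
  "\<forall>(as, is) \<in> set reflection_table.
     (\<forall>a \<in> set as. length a = 6 \<and> quad_list a = 1) \<and> (\<forall>i \<in> set is. 1 \<le> i \<and> i \<le> 30) \<and>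
     list_all2 (\<lambda>bs i. set (map (fold reflect_list as) (combos 6 bs)) = set (combos 6 (Y_bases ! (i - 1))))
       C_bases is"
  by code_simp

text \<open>The extra generator of each entry of \<open>C_bases\<close> accounts for the last
  hyperbolic pair of the standard space, where the second coordinate is 0 and the first is
  free.\<close>

lemma B_C_check:
  "\<forall>(bs, cs) \<in> set (zip B_bases C_bases). (\<forall>b \<in> set bs. length b = 4) \<and> (\<forall>c \<in> set cs. length c = 6) \<and>
     set (combos 6 cs) = set (concat (map (\<lambda>p. map ((@) p) (combos 4 bs)) [[0, 0], [1, 0]]))"
  by code_simp

lemma std_isotropic_Suc:
  "std_isotropic (Suc k) = dsum (std_isotropic k) (vec_of_list ` {[0, 0], [1, 0]})"
proof (intro equalityI subsetI)
  fix v assume v: "v \<in> std_isotropic (Suc k)"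
  define u where "u = vec_first v (2 * k)"
  have vc: "v \<in> carrier_vec (2 * k + 2)"
    using v by (simp add: std_isotropic_def)
  have "v = u @\<^sub>v vec_of_list [v $ (2 * k), 0]"
  proof (rule eq_vecI)
    fix i assume i: "i < dim_vec (u @\<^sub>v vec_of_list [v $ (2 * k), 0])"
    show "v $ i = (u @\<^sub>v vec_of_list [v $ (2 * k), 0]) $ i"
    proof (cases "i < 2 * k")
      case False
      then have "i = 2 * k \<or> i = 2 * k + 1"
        using i by (auto simp: u_def)
      then show ?thesis
        using v by (auto simp: u_def std_isotropic_def vec_of_list_index simp del: vec_of_list_Cons)
    qed (simp add: u_def vec_first_def)
  qed (use vc in \<open>simp add: u_def\<close>)
  moreover have "u \<in> std_isotropic k"
    using v by (auto simp: std_isotropic_def u_def vec_first_def)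
  moreover have "vec_of_list [v $ (2 * k), 0] \<in> vec_of_list ` {[0, 0], [1, 0]}"
    by (cases "v $ (2 * k)") auto
  ultimately show "v \<in> dsum (std_isotropic k) (vec_of_list ` {[0, 0], [1, 0]})"
    unfolding dsum_def by blast
next
  fix v assume "v \<in> dsum (std_isotropic k) (vec_of_list ` {[0, 0], [1, 0]})"
  then obtain u c where uc: "v = u @\<^sub>v vec_of_list [c, 0]" "u \<in> std_isotropic k"
    by (auto simp: dsum_def simp del: vec_of_list_Cons)
  then show "v \<in> std_isotropic (Suc k)"
    by (auto simp: std_isotropic_def vec_of_list_index less_Suc_eq simp del: vec_of_list_Cons intro!: carrier_vecI)
qed

lemma dsum_image: "dsum U (f ` S) = (\<lambda>(u, x). u @\<^sub>v f x) ` (U \<times> S)"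
  by (auto simp: dsum_def)

lemma dsum_dsum_vec_of_list:
  "dsum (dsum U (vec_of_list ` P)) (vec_of_list ` Q) = dsum U (vec_of_list ` (\<Union>p \<in> P. (@) p ` Q))"
proof (intro equalityI subsetI)
  fix v assume "v \<in> dsum (dsum U (vec_of_list ` P)) (vec_of_list ` Q)"
  then obtain u p q where "u \<in> U" "p \<in> P" "q \<in> Q" "v = (u @\<^sub>v vec_of_list p) @\<^sub>v vec_of_list q"
    unfolding dsum_def by blast
  then have "v = u @\<^sub>v vec_of_list (p @ q)" "p @ q \<in> (\<Union>p \<in> P. (@) p ` Q)" "u \<in> U"
    by (auto simp: append_vec_assoc vec_of_list_append)
  then show "v \<in> dsum U (vec_of_list ` (\<Union>p \<in> P. (@) p ` Q))"
    unfolding dsum_def by blast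
next
  fix v assume "v \<in> dsum U (vec_of_list ` (\<Union>p \<in> P. (@) p ` Q))"
  then obtain u p q where "u \<in> U" "p \<in> P" "q \<in> Q" "v = u @\<^sub>v vec_of_list (p @ q)"
    unfolding dsum_def by blast
  then have "v = (u @\<^sub>v vec_of_list p) @\<^sub>v vec_of_list q" "u \<in> U" "p \<in> P" "q \<in> Q"
    by (simp_all add: append_vec_assoc vec_of_list_append)
  then show "v \<in> dsum (dsum U (vec_of_list ` P)) (vec_of_list ` Q)"
    unfolding dsum_def by blast
qed

text \<open>For m = k + 3 the standard part of \<open>I_space\<close> has k + 1 hyperbolic pairs.
  Moving the last one to the other summand matches the decomposition used for the spaces
  \<open>Y_space\<close>.\<close>

lemma I_space_eq:
  assumes "1 \<le> j" "j \<le> 6"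
  shows "I_space (k + 3) j = dsum (std_isotropic k) (vec_of_list ` set (combos 6 (C_bases ! (j - 1))))"
proof -
  let ?B = "B_bases ! (j - 1)" and ?C = "C_bases ! (j - 1)"
  have "length B_bases = 6" "length C_bases = 6"
    by (simp_all add: C_bases_def B_bases_def)
  then have "(?B, ?C) \<in> set (zip B_bases C_bases)"
    using assms by (force simp: in_set_zip intro: exI[of _ "j - 1"])
  then have chk: "\<forall>b \<in> set ?B. length b = 4"
    "set (combos 6 ?C) = (\<Union>p \<in> {[0, 0], [1, 0]}. (@) p ` set (combos 4 ?B))"
    using B_C_check by fastforce+
  have "I_space (k + 3) j = dsum (std_isotropic (Suc k)) (vec_of_list ` set (combos 4 ?B))"
    unfolding I_space_def B_space_def list_span_eq[OF chk(1)] by simp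
  also have "\<dots> = dsum (std_isotropic k) (vec_of_list ` set (combos 6 ?C))"
    unfolding std_isotropic_Suc chk(2) by (rule dsum_dsum_vec_of_list)
  finally show ?thesis .
qed

lemma Y_bases_length: "bs \<in> set Y_bases \<Longrightarrow> b \<in> set bs \<Longrightarrow> length b = 6"
  using Y_bases_check by auto

lemma Y_bases_nth: "1 \<le> i \<Longrightarrow> i \<le> 30 \<Longrightarrow> Y_bases ! (i - 1) \<in> set Y_bases"
proof -
  have "length Y_bases = 30" by (simp add: Y_bases_def)
  then show "1 \<le> i \<Longrightarrow> i \<le> 30 \<Longrightarrow> ?thesis" by (intro nth_mem) simp
qed

lemma max_totally_isotropic_Y:
  assumes "1 \<le> i" "i \<le> 30"
  shows "max_totally_isotropic (k + 3) (dsum (std_isotropic k) (Y_space i))"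
proof -
  let ?bs = "Y_bases ! (i - 1)"
  have "?bs \<in> set Y_bases"
    using Y_bases_nth[OF assms] .
  then have "\<forall>xs \<in> set (combos 6 ?bs). quad_list xs = 0"
    "\<forall>xs \<in> set (bit_lists 6). (\<forall>b \<in> set (combos 6 ?bs). polar_list xs b = 0) \<longrightarrow> xs \<in> set (combos 6 ?bs)"
    "\<forall>b \<in> set ?bs. length b = 6"
    using Y_bases_check by (auto simp: Let_def)
  then show ?thesis
    using max_totally_isotropic_dsum[of ?bs 3 k]
    by (simp add: Y_space_def set_bit_lists)
qed

text \<open>Each row thus yields an orthogonal g whose relations are relations among six of the
  thirty variables, for every k. The image is computed in the second summand alone, as the
  reflections fix the first.\<close>

lemma reflection_table_image:
  assumes "(as, is) \<in> set reflection_table"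
  shows "\<exists>g \<in> orthogonal_group (k + 3). \<forall>j. 1 \<le> j \<longrightarrow> j \<le> 6 \<longrightarrow>
    (*\<^sub>v) g ` I_space (k + 3) j = dsum (std_isotropic k) (Y_space (is ! (j - 1)))"
proof -
  have as: "\<forall>a \<in> set as. length a = 2 * 3 \<and> quad_list a = 1"
    and is': "\<forall>i \<in> set is. 1 \<le> i \<and> i \<le> 30"
    and img: "list_all2 (\<lambda>bs i. set (map (fold reflect_list as) (combos 6 bs)) = set (combos 6 (Y_bases ! (i - 1))))
       C_bases is"
    using reflection_table_check assms by fastforce+
  have "set (map vec_of_list as) \<subseteq> carrier_vec (2 * 3)" "\<forall>a \<in> set (map vec_of_list as). quad 3 a = 1"
    using as by (auto simp: quad_vec_of_list intro!: carrier_vecI)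
  from reflections_orthogonal[OF this, of k] obtain g where g: "g \<in> orthogonal_group (k + 3)"
    "\<And>u w. u \<in> carrier_vec (2 * k) \<Longrightarrow> w \<in> carrier_vec (2 * 3) \<Longrightarrow>
      g *\<^sub>v (u @\<^sub>v w) = u @\<^sub>v fold (\<lambda>a w. w + polar 3 w a \<cdot>\<^sub>v a) (map vec_of_list as) w"
    by blast
  have "(*\<^sub>v) g ` I_space (k + 3) j = dsum (std_isotropic k) (Y_space (is ! (j - 1)))"
    if j: "1 \<le> j" "j \<le> 6" for j
  proof -
    let ?C = "combos 6 (C_bases ! (j - 1))" and ?Y = "combos 6 (Y_bases ! (is ! (j - 1) - 1))"
    have nth: "j - 1 < length is" "length C_bases = 6" "is ! (j - 1) \<in> set is"
      using j list_all2_lengthD[OF img] by (simp_all add: C_bases_def B_bases_def)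
    have Y: "set ?Y = fold reflect_list as ` set ?C"
      using list_all2_nthD2[OF img nth(1)] by simp
    have "(B_bases ! (j - 1), C_bases ! (j - 1)) \<in> set (zip B_bases C_bases)"
      using nth j by (force simp: in_set_zip C_bases_def intro: exI[of _ "j - 1"])
    then have lenC: "\<forall>b \<in> set (C_bases ! (j - 1)). length b = 6"
      using B_C_check by fastforce
    have Y_space: "Y_space (is ! (j - 1)) = vec_of_list ` set ?Y"
      unfolding Y_space_def using is' nth(3) Y_bases_length[OF Y_bases_nth]
      by (intro list_span_eq) auto
    have "g *\<^sub>v (u @\<^sub>v vec_of_list xs) = u @\<^sub>v vec_of_list (fold reflect_list as xs)"
      if "u \<in> std_isotropic k" "xs \<in> set ?C" for u xs
    proof -
      have "length xs = 2 * 3"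
        using length_combos[OF lenC that(2)] by simp
      moreover from this have "vec_of_list xs \<in> carrier_vec (2 * 3)"
        by (auto intro!: carrier_vecI)
      ultimately show ?thesis
        using that(1) as g(2)[of u "vec_of_list xs"] fold_vec_of_list[of xs 3 as]
        by (simp add: std_isotropic_def)
    qed
    then show ?thesis
      unfolding I_space_eq[OF j] Y_space Y image_image dsum_image by (intro image_cong) auto
  qed
  with g(1) show ?thesis by blast
qed

section \<open>The 35 lines and the null polarity\<close>

text \<open>
  The points and planes on the 35 lines. The type \<^typ>\<open>int\<close> makes the numerals cheap to compare in
  the check of all 720 orderings below.
\<close>

definition line_list :: "(int list \<times> int list) list" where
  "line_list = [
    ([1, 4, 6], [2, 3, 5]), ([8, 9, 11], [7, 10, 12]), ([1, 8, 14], [2, 7, 13]),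
    ([1, 16, 18], [2, 15, 17]), ([8, 19, 21], [7, 20, 22]), ([4, 9, 23], [3, 10, 24]),
    ([4, 19, 25], [3, 20, 26]), ([9, 16, 28], [10, 15, 27]), ([16, 19, 29], [15, 20, 30]),
    ([1, 9, 19], [3, 7, 15]), ([1, 23, 25], [3, 13, 17]), ([9, 14, 21], [7, 24, 27]),
    ([1, 11, 21], [5, 7, 17]), ([1, 28, 29], [5, 13, 15]), ([11, 14, 19], [7, 26, 30]),
    ([6, 9, 25], [3, 12, 27]), ([6, 19, 23], [3, 22, 30]), ([9, 18, 29], [12, 15, 24]),
    ([18, 19, 28], [15, 22, 26]), ([4, 8, 16], [2, 10, 20]), ([4, 14, 18], [2, 24, 26]),
    ([8, 23, 28], [10, 13, 22]), ([6, 8, 18], [2, 12, 22]), ([6, 14, 16], [2, 27, 30]),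
    ([8, 25, 29], [12, 13, 20]), ([4, 11, 28], [5, 10, 26]), ([4, 21, 29], [5, 20, 24]),
    ([11, 16, 23], [10, 17, 30]), ([16, 21, 25], [17, 20, 27]), ([14, 23, 29], [13, 24, 30]),
    ([14, 25, 28], [13, 26, 27]), ([18, 21, 23], [17, 22, 24]), ([6, 11, 29], [5, 12, 30]),
    ([6, 21, 28], [5, 22, 27]), ([11, 18, 25], [12, 17, 26])]"

text \<open>The null polarity, with the six-element set taken to be $\{0, \dots, 5\}$.\<close>

definition point_label :: "int list list" where
  "point_label = [[0, 9, 1, 25, 29, 21], [9, 0, 19, 6, 18, 14], [1, 19, 0, 23, 28, 11], [25, 6, 23, 0, 8, 16], [29, 18, 28, 8, 0, 4], [21, 14, 11, 16, 4, 0]]"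

definition plane_label :: "int list list" where
  "plane_label = [[0, 10, 2, 26, 30, 22], [10, 0, 20, 5, 17, 13], [2, 20, 0, 24, 27, 12], [26, 5, 24, 0, 7, 15], [30, 17, 27, 7, 0, 3], [22, 13, 12, 15, 3, 0]]"

text \<open>Positions 0, 2, 4 of a row hold the images of I_1, I_3, I_5, and positions 1, 3, 5 those
  of I_2, I_4, I_6: the two sides of the linear relation.\<close>

lemma line_list_check:
  "line_list = map (\<lambda>(as, is). (sort (map int [is ! 0, is ! 2, is ! 4]), sort (map int [is ! 1, is ! 3, is ! 5]))) reflection_table"
  by code_simp

lemma label_check:
  "\<forall>M \<in> set [point_label, plane_label]. \<forall>i \<in> set [0..<6]. M ! i ! i = 0 \<and>
    (\<forall>j \<in> set [0..<6]. M ! i ! j = M ! j ! i \<and> 0 \<le> M ! i ! j \<and> M ! i ! j \<le> 30)"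
  by code_simp

text \<open>Nested removal visits exactly the 720 orderings instead of filtering all 6^6
  tuples.\<close>

lemma line_label_check:
  "\<forall>i \<in> set [0..<6]. let A = removeAll i [0..<6] in \<forall>j \<in> set A. let B = removeAll j A in
     \<forall>k \<in> set B. let C = removeAll k B in \<forall>l \<in> set C. let D = removeAll l C in
     \<forall>m \<in> set D. \<forall>n \<in> set (removeAll m D).
       (sort [point_label ! i ! j, point_label ! k ! l, point_label ! m ! n],
         sort [plane_label ! i ! j, plane_label ! k ! l, plane_label ! m ! n]) \<in> set line_list \<and>
       (sort [point_label ! i ! j, point_label ! j ! k, point_label ! i ! k],
         sort [plane_label ! l ! m, plane_label ! m ! n, plane_label ! l ! n]) \<in> set line_list"
  by code_simp

lemma sum_list_map_sort: "sum_list (map h (sort xs)) = sum_list (map (h :: _ \<Rightarrow> 'a :: comm_monoid_add) xs)"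
  by (metis mset_map mset_sort sum_mset_sum_list)

lemma line_label:
  assumes "distinct [i, j, k, l, m, n]" "{i, j, k, l, m, n} = {..<6::nat}"
  shows "(sort [point_label ! i ! j, point_label ! k ! l, point_label ! m ! n],
      sort [plane_label ! i ! j, plane_label ! k ! l, plane_label ! m ! n]) \<in> set line_list"
    and "(sort [point_label ! i ! j, point_label ! j ! k, point_label ! i ! k],
      sort [plane_label ! l ! m, plane_label ! m ! n, plane_label ! l ! n]) \<in> set line_list"
proof -
  have "i < 6" "j < 6" "k < 6" "l < 6" "m < 6" "n < 6"
    using assms(2) by blast+
  then have "i \<in> set [0..<6]" "j \<in> set (removeAll i [0..<6])" "k \<in> set (removeAll j (removeAll i [0..<6]))"
    "l \<in> set (removeAll k (removeAll j (removeAll i [0..<6])))"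
    "m \<in> set (removeAll l (removeAll k (removeAll j (removeAll i [0..<6]))))"
    "n \<in> set (removeAll m (removeAll l (removeAll k (removeAll j (removeAll i [0..<6])))))"
    using assms(1) by auto
  note check = line_label_check[unfolded Let_def, THEN bspec, OF this(1), THEN bspec, OF this(2), THEN bspec, OF this(3),
    THEN bspec, OF this(4), THEN bspec, OF this(5), THEN bspec, OF this(6)]
  show "(sort [point_label ! i ! j, point_label ! k ! l, point_label ! m ! n],
      sort [plane_label ! i ! j, plane_label ! k ! l, plane_label ! m ! n]) \<in> set line_list"
    "(sort [point_label ! i ! j, point_label ! j ! k, point_label ! i ! k],
      sort [plane_label ! l ! m, plane_label ! m ! n, plane_label ! l ! n]) \<in> set line_list"
    using check by blast+
qed

section \<open>Membership of the quartic in the ideal\<close>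

text \<open>\<open>class_ring\<close> has the operations of the type and only its carrier is
  restricted, so an ideal in the sense of HOL-Algebra gives an instance of the locale.\<close>

lemma diff_ring_subring_ideal:
  assumes "ideal I (class_ring\<lparr>carrier := diff_ring m\<rparr>)"
  shows "subring_ideal (diff_ring m) I"
proof -
  interpret ideal I "class_ring\<lparr>carrier := diff_ring m\<rparr>" by fact
  have minus: "- a \<in> diff_ring m" if "a \<in> diff_ring m" for a
    using generate_ring.a_inv[OF that[unfolded diff_ring_def]] by (simp add: diff_ring_def class_ring_simps)
  have plus: "a + b \<in> diff_ring m" if "a \<in> diff_ring m" "b \<in> diff_ring m" for a b
    using generate_ring.eng_add[OF that[unfolded diff_ring_def]] by (simp add: diff_ring_def)
  show ?thesis
  proof
    show "1 \<in> diff_ring m"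
      using generate_ring.one[of class_ring] by (simp add: diff_ring_def)
    show "a - b \<in> diff_ring m" if "a \<in> diff_ring m" "b \<in> diff_ring m" for a b
      using plus[OF that(1) minus[OF that(2)]] by simp
    show "a * b \<in> diff_ring m" if "a \<in> diff_ring m" "b \<in> diff_ring m" for a b
      using generate_ring.eng_mult[OF that[unfolded diff_ring_def]] by (simp add: diff_ring_def)
    show "a \<in> diff_ring m" if "a \<in> I" for a
      using a_subset that by auto
    show "0 \<in> I"
      using additive_subgroup.zero_closed[OF is_additive_subgroup] by simp
    show "a + b \<in> I" if "a \<in> I" "b \<in> I" for a b
      using additive_subgroup.a_closed[OF is_additive_subgroup that] by simp
    show "a * r \<in> I" if "a \<in> I" "r \<in> diff_ring m" for a r
      using I_r_closed[OF that(1)] that(2) by simp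
  qed
qed

text \<open>Provides the inverse of 3072 inside the ring of differences.\<close>

lemma constants_closed: "Poly_Mapping.single 0 c \<in> diff_ring m"
  unfolding diff_ring_def by (rule generate_ring.incl) (simp add: constants_def)

lemma star_quartic_in_rel_ideal:
  fixes k :: nat
  defines "X \<equiv> \<lambda>i. Xvar (dsum (std_isotropic k) (Y_space i))"
  shows "(X 29 - X 30) * (X 17 - X 18) * (X 27 - X 28) * (X 7 - X 8)
       + (X 11 - X 12) * (X 13 - X 14) * (X 15 - X 16) * (X 21 - X 22) \<in> rel_ideal (k + 3)" (is "?T \<in> _")
  unfolding rel_ideal_def genideal_def
\<comment> \<open>\<open>genideal\<close> is an intersection, so it is enough to treat an arbitrary
  ideal \<open>I\<close> that contains the generators.\<close>
proof (intro InterI, clarify)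
  fix I :: "cpoly set"
  assume "ideal I (class_ring\<lparr>carrier := diff_ring (k + 3)\<rparr>)"
    and gens: "(\<Union>g \<in> orthogonal_group (k + 3). relations (\<lambda>j. Xvar ((*\<^sub>v) g ` I_space (k + 3) j))) \<subseteq> I"
  then interpret subring_ideal "diff_ring (k + 3)" I
    by (intro diff_ring_subring_ideal)
  \<comment> \<open>Single variables are not in \<open>diff_ring\<close>, but the relations involve only differences; index 0
    marks the diagonal of the label tables.\<close>
  define y :: "int \<Rightarrow> cpoly" where "y = (\<lambda>i. if i = 0 then 0 else X (nat i) - X 1)"
  have y_closed: "y i \<in> diff_ring (k + 3)" if "0 \<le> i" "i \<le> 30" for i
  proof (cases "i = 0")
    case False
    then have "max_totally_isotropic (k + 3) (dsum (std_isotropic k) (Y_space (nat i)))"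
      "max_totally_isotropic (k + 3) (dsum (std_isotropic k) (Y_space 1))"
      using that by (intro max_totally_isotropic_Y; simp)+
    then show ?thesis
      using False unfolding diff_ring_def y_def X_def by (auto intro!: generate_ring.incl)
  qed (simp add: y_def)
  \<comment> \<open>Sorting is harmless because the sums are symmetric in the points and in the
    planes of a line.\<close>
  have y_line: "sum_list (map y ps) - sum_list (map y qs) \<in> I"
      "sum_list (map (\<lambda>i. y i ^ 2) ps) - sum_list (map (\<lambda>i. y i ^ 2) qs) \<in> I"
    if line: "(sort ps, sort qs) \<in> set line_list" for ps qs
  proof -
    obtain as "is" where row: "(as, is) \<in> set reflection_table"
      and sort_eq: "sort ps = sort (map int [is ! 0, is ! 2, is ! 4])" "sort qs = sort (map int [is ! 1, is ! 3, is ! 5])"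
      using line unfolding line_list_check by auto
    have "length is = 6" "\<forall>i \<in> set is. 1 \<le> i \<and> i \<le> 30"
      using reflection_table_check row list_all2_lengthD by (fastforce simp: C_bases_def B_bases_def)+
    then have range: "1 \<le> is ! j" "is ! j \<le> 30" if "j < 6" for j
      using that by simp_all
    obtain g where g: "g \<in> orthogonal_group (k + 3)" "\<forall>j. 1 \<le> j \<longrightarrow> j \<le> 6 \<longrightarrow>
        (*\<^sub>v) g ` I_space (k + 3) j = dsum (std_isotropic k) (Y_space (is ! (j - 1)))"
      using reflection_table_image[OF row] by blast
    define Z where "Z = (\<lambda>j. Xvar ((*\<^sub>v) g ` I_space (k + 3) j))"
    define w where "w = (\<lambda>j. y (int (is ! j)))"
    \<comment> \<open>Rows are indexed from 0, the Z_j from 1. The common shift \<open>X 1\<close>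
      cancels in every difference, and in the linear relation because it has three terms of each
      sign.\<close>
    have Z: "Z (Suc j) = w j + X 1" if "j < 6" for j
      using g(2) that range[OF that] by (simp add: Z_def w_def y_def X_def)
    have w: "w j \<in> diff_ring (k + 3)" if "j < 6" for j
      using range[OF that] unfolding w_def by (intro y_closed) auto
    have rel: "relations Z \<subseteq> I"
      using gens g(1) unfolding Z_def by blast
    have Z_eqs: "Z 1 = w 0 + X 1" "Z 2 = w 1 + X 1" "Z 3 = w 2 + X 1" "Z 4 = w 3 + X 1" "Z 5 = w 4 + X 1"
      "Z 6 = w 5 + X 1"
      using Z[of 0] Z[of 1] Z[of 2] Z[of 3] Z[of 4] Z[of 5] by (simp_all add: eval_nat_numeral)
    have "Z 1 + Z 3 + Z 5 - Z 2 - Z 4 - Z 6 \<in> I" "(Z 1 - Z 2) * (Z 1 - Z 4) - (Z 3 - Z 6) * (Z 5 - Z 6) \<in> I"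
      using rel unfolding relations_def by blast+
    moreover have "Z 1 + Z 3 + Z 5 - Z 2 - Z 4 - Z 6 = w 0 + w 2 + w 4 - w 1 - w 3 - w 5"
      unfolding Z_eqs by (simp add: algebra_simps)
    moreover have "(Z 1 - Z 2) * (Z 1 - Z 4) - (Z 3 - Z 6) * (Z 5 - Z 6)
        = (w 0 - w 1) * (w 0 - w 3) - (w 2 - w 5) * (w 4 - w 5)"
      unfolding Z_eqs by simp
    ultimately have lin: "w 0 + w 2 + w 4 - w 1 - w 3 - w 5 \<in> I"
      and quad: "(w 0 - w 1) * (w 0 - w 3) - (w 2 - w 5) * (w 4 - w 5) \<in> I"
      by (simp_all only:)
    have sort_map: "sum_list (map h ps) = h (int (is ! 0)) + h (int (is ! 2)) + h (int (is ! 4))"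
      "sum_list (map h qs) = h (int (is ! 1)) + h (int (is ! 3)) + h (int (is ! 5))" for h :: "int \<Rightarrow> cpoly"
      using sum_list_map_sort[of h ps] sum_list_map_sort[of h qs]
        sum_list_map_sort[of h "map int [is ! 0, is ! 2, is ! 4]"]
        sum_list_map_sort[of h "map int [is ! 1, is ! 3, is ! 5]"]
      unfolding sort_eq by (simp_all add: add.assoc)
    show "sum_list (map y ps) - sum_list (map y qs) \<in> I"
      unfolding sort_map using lin by (simp add: w_def diff_diff_eq)
    show "sum_list (map (\<lambda>i. y i ^ 2) ps) - sum_list (map (\<lambda>i. y i ^ 2) qs) \<in> I"
      unfolding sort_map using square_relation[OF w w w w w w lin quad] by (simp add: w_def)
  qed
  \<comment> \<open>The value 0 outside the 6 by 6 table makes symmetry and closure hold for all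
    indices, as \<open>duad_labelling\<close> demands.\<close>
  define lab where "lab = (\<lambda>M i j. if i < 6 \<and> j < 6 then y (M ! i ! j) else 0)"
  have lab: "duad_labelling (lab M)" "\<And>i j. lab M i j \<in> diff_ring (k + 3)"
    if "M \<in> {point_label, plane_label}" for M
  proof -
    have M: "M ! i ! i = 0 \<and> M ! i ! j = M ! j ! i \<and> 0 \<le> M ! i ! j \<and> M ! i ! j \<le> 30" if "i < 6" "j < 6" for i j
      using label_check \<open>M \<in> _\<close> that by auto
    show "duad_labelling (lab M)"
      using M by (simp add: duad_labelling_def lab_def y_def)
    show "lab M i j \<in> diff_ring (k + 3)" for i j
      using M by (simp add: lab_def y_closed)
  qed
  \<comment> \<open>The function \<open>h\<close> will be the identity and then squaring.\<close>
  have rel: "line_relations I (\<lambda>i j. h (lab point_label i j)) (\<lambda>i j. h (lab plane_label i j))"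
    if "\<And>ps qs. (sort ps, sort qs) \<in> set line_list \<Longrightarrow>
      sum_list (map (\<lambda>i. h (y i)) ps) - sum_list (map (\<lambda>i. h (y i)) qs) \<in> I" for h
    unfolding line_relations_def
  proof (intro allI impI)
    fix i j k l m n :: nat
    assume P: "distinct [i, j, k, l, m, n]" "{i, j, k, l, m, n} = {..<6}"
    then have "i < 6" "j < 6" "k < 6" "l < 6" "m < 6" "n < 6"
      by blast+
    then show "h (lab point_label i j) + h (lab point_label k l) + h (lab point_label m n)
        - (h (lab plane_label i j) + h (lab plane_label k l) + h (lab plane_label m n)) \<in> I \<and>
      h (lab point_label i j) + h (lab point_label j k) + h (lab point_label i k)
        - (h (lab plane_label l m) + h (lab plane_label m n) + h (lab plane_label l n)) \<in> I"
      using line_label[OF P, THEN that] by (simp add: lab_def add.assoc)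
  qed
  \<comment> \<open>The star of 5 carries two minus signs and the star of 4 three. Hence the
    difference of the two products becomes the sum in the quartic.\<close>
  have differences:
    "lab point_label 0 5 - lab plane_label 0 5 = X 21 - X 22" "lab point_label 1 5 - lab plane_label 1 5 = - (X 13 - X 14)"
    "lab point_label 2 5 - lab plane_label 2 5 = X 11 - X 12" "lab point_label 3 5 - lab plane_label 3 5 = - (X 15 - X 16)"
    "lab point_label 0 4 - lab plane_label 0 4 = X 29 - X 30" "lab point_label 1 4 - lab plane_label 1 4 = - (X 17 - X 18)"
    "lab point_label 2 4 - lab plane_label 2 4 = - (X 27 - X 28)" "lab point_label 3 4 - lab plane_label 3 4 = - (X 7 - X 8)"
    by (simp_all add: lab_def y_def point_label_def plane_label_def)
  have "3072 * ((\<Prod>i<4. lab point_label i 5 - lab plane_label i 5)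
      - (\<Prod>i<4. lab point_label i 4 - lab plane_label i 4)) \<in> I"
    unfolding cong_0_iff[symmetric]
  proof (rule star_quartic_cong_0)
    show "line_relations I (lab point_label) (lab plane_label)"
      using rel[of "\<lambda>x. x"] y_line(1) by blast
    show "line_relations I (\<lambda>i j. lab point_label i j ^ 2) (\<lambda>i j. lab plane_label i j ^ 2)"
      using y_line(2) by (rule rel)
  qed (simp_all add: lab)
  also have "(\<Prod>i<4. lab point_label i 5 - lab plane_label i 5)
      - (\<Prod>i<4. lab point_label i 4 - lab plane_label i 4) = ?T"
    unfolding prod_lessThan_4 differences by (simp only: mult_minus_left mult_minus_right minus_minus
      diff_minus_eq_add ac_simps)
  finally have "3072 * ?T \<in> I" .
  moreover have "3072 * (Poly_Mapping.single 0 (1 / 3072) :: cpoly) = 1"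
  proof -
    have "3072 * (Poly_Mapping.single 0 (1 / 3072) :: cpoly)
        = Poly_Mapping.single 0 3072 * Poly_Mapping.single 0 (1 / 3072)"
      by simp
    also have "\<dots> = 1"
      unfolding mult_single by simp
    finally show ?thesis .
  qed
  ultimately show "?T \<in> I"
    using constants_closed ideal_cancel by blast
qed

theorem proposition2p10:
  fixes m :: nat and x :: "nat \<Rightarrow> cpoly"
  assumes "m \<ge> 3"
    and "\<And>i. 1 \<le> i \<Longrightarrow> i \<le> 30 \<Longrightarrow> x i = Xvar (dsum (std_isotropic (m - 3)) (Y_space i))"
  shows "(x 29 - x 30) * (x 17 - x 18) * (x 27 - x 28) * (x 7 - x 8)
       + (x 11 - x 12) * (x 13 - x 14) * (x 15 - x 16) * (x 21 - x 22) \<in> rel_ideal m"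
  using star_quartic_in_rel_ideal[of "m - 3"] assms by simp

end
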